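(* Let $K$ be the self-similar set of a finite type IFS (setting described in the context) with contraction ratio $\varrho$, and let $I$ be the incidence matrix of the essential class. Then $$\dim_H K=\frac{\log(\mathrm{sp}(I))}{|\log\varrho|},$$ where $\mathrm{sp}$ denotes the spectral radius.
   Context: Setting. Let $m\ge 1$ be an integer, $0<\varrho<1$, $0=d_0<d_1<\dots<d_m$, $S_j(x)=\varrho x+d_j$ for $j\in\mathcal A=\{0,\dots,m\}$. Let $K$ be the unique non-empty compact set with $K=\bigcup_j S_j(K)$; the $d_j$ are scaled so that the convex hull of $K$ is $[0,1]$ ($K$ need not be an interval). For $\sigma=(j_1,\dots,j_n)\in\mathcal A^n$ put $S_\sigma=S_{j_1}\circ\cdots\circ S_{j_n}$. The IFS is of finite type if there is a finite set $F\subseteq\mathbb R$ such that for every $n\ge1$ and all $\sigma,\sigma'\in\mathcal A^n$, either $\varrho^{-n}|S_\sigma(0)-S_{\sigma'}(0)|>1$ or $\varrho^{-n}(S_\sigma(0)-S_{\sigma'}(0))\in F$. Net intervals. Let $h_1<\dots<h_{s_n}$ be the elements of $\{S_\sigma(0),S_\sigma(1):\sigma\in\mathcal A^n\}$; $\mathcal F_n$ (net intervals of level $n$) is the set of $[h_j,h_{j+1}]$ with $(h_j,h_{j+1})\cap K\ne\emptyset$; $\mathcal F_0=\{[0,1]\}$. Each $\Delta\in\mathcal F_n$, $n\ge1$, is contained in a unique $\widehat\Delta\in\mathcal F_{n-1}$, its parent ($\Delta$ is a child of $\widehat\Delta$). For $\Delta=[a,b]\in\mathcal F_n$: normalized length $\ell_n(\Delta)=\varrho^{-n}(b-a)$;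 neighbour set $V_n(\Delta)$ = the increasingly ordered tuple of the distinct elements of $\{\varrho^{-n}(a-S_\sigma(0)):\sigma\in\mathcal A^n,\ \Delta\subseteq S_\sigma[0,1]\}$; $r_n(\Delta)$ = position of $\Delta$, from left to right, among the level $n$ net intervals with the same parent and the same normalized length. The characteristic vector is $(\ell_n(\Delta),V_n(\Delta),r_n(\Delta))$, and the reduced characteristic vector is $(\ell_n(\Delta),V_n(\Delta))$. Under finite type the set $\Omega$ of characteristic vectors is finite, and the (reduced) characteristic vectors of the children of $\Delta$, with multiplicity, depend only on the reduced characteristic vector of $\Delta$. An admissible path is a finite sequence of characteristic vectors, each being the parent of the next. A loop class is a non-empty $\Omega'\subseteq\Omega$ such that any $\alpha,\beta\in\Omega'$ are joined by an admissible path from $\alpha$ to $\beta$ inside $\Omega'$; it is an essential class if in addition all children of elements of $\Omega'$ are in $\Omega'$. There is exactly one essential class $\Omega_0$ (known). Incidence matrix. Let $\gamma_1,\dots,\gamma_r$ be the complete list of the reduced characteristic vectors of the elements of the essential class. The incidence matrix of the essential class is the $r\times r$ matrix $I$ with $I_{jk}$ = the number of children of $\gamma_j$ whose reduced characteristic vector is $\gamma_k$. *)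

theory Defs
  imports "HOL-Analysis.Analysis" "Jordan_Normal_Form.Spectral_Radius"
begin

section \<open>Hausdorff dimension\<close>

text \<open>The \<open>s\<close>-th power of the diameter, with the usual conventions at \<open>s = 0\<close>: the empty set
  contributes 0 and every other set contributes 1 (whereas \<open>0 powr 0 = 0\<close> in HOL).\<close>

definition hausdorff_gauge :: "real \<Rightarrow> 'a::metric_space set \<Rightarrow> ennreal" where
  "hausdorff_gauge s U =
     (if U = {} then 0 else if s = 0 then 1 else ennreal (diameter U powr s))"

text \<open>Boundedness is required explicitly because \<^const>\<open>diameter\<close> is unspecified on
  unbounded sets.\<close>

definition hausdorff_content :: "real \<Rightarrow> real \<Rightarrow> 'a::metric_space set \<Rightarrow> ennreal" where
  "hausdorff_content \<delta> s A =
     (INF U\<in>{U :: nat \<Rightarrow> 'a set. A \<subseteq> (\<Union>i. U i) \<and> (\<forall>i. bounded (U i) \<and> diameter (U i) \<le> \<delta>)}.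
        \<Sum>i. hausdorff_gauge s (U i))"

definition hausdorff_measure :: "real \<Rightarrow> 'a::metric_space set \<Rightarrow> ennreal" where
  "hausdorff_measure s A = (SUP \<delta>\<in>{0<..}. hausdorff_content \<delta> s A)"

definition hausdorff_dim :: "'a::metric_space set \<Rightarrow> ereal" where
  "hausdorff_dim A = (INF s\<in>{s. 0 \<le> s \<and> hausdorff_measure s A = 0}. ereal s)"


section \<open>The iterated function system\<close>

definition ifs_map :: "real \<Rightarrow> (nat \<Rightarrow> real) \<Rightarrow> nat \<Rightarrow> real \<Rightarrow> real" where
  "ifs_map \<rho> d j x = \<rho> * x + d j"

definition word_map :: "real \<Rightarrow> (nat \<Rightarrow> real) \<Rightarrow> nat list \<Rightarrow> real \<Rightarrow> real" where
  "word_map \<rho> d \<sigma> = foldr (\<lambda>j f. ifs_map \<rho> d j \<circ> f) \<sigma> id"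

definition words :: "nat \<Rightarrow> nat \<Rightarrow> nat list set" where
  "words m n = {\<sigma>. length \<sigma> = n \<and> set \<sigma> \<subseteq> {0..m}}"

definition finite_type :: "nat \<Rightarrow> real \<Rightarrow> (nat \<Rightarrow> real) \<Rightarrow> bool" where
  "finite_type m \<rho> d \<longleftrightarrow>
     (\<exists>F. finite F \<and>
        (\<forall>n\<ge>1. \<forall>\<sigma>\<in>words m n. \<forall>\<sigma>'\<in>words m n.
           \<bar>word_map \<rho> d \<sigma> 0 - word_map \<rho> d \<sigma>' 0\<bar> / \<rho> ^ n > 1 \<or>
           (word_map \<rho> d \<sigma> 0 - word_map \<rho> d \<sigma>' 0) / \<rho> ^ n \<in> F))"


section \<open>Net intervals and characteristic vectors\<close>

text \<open>An interval \<open>[a, b]\<close> is represented by the pair \<open>(a, b)\<close>.\<close>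

type_synonym ivl = "real \<times> real"
type_synonym red_vec = "real \<times> real list"
type_synonym char_vec = "real \<times> real list \<times> nat"

abbreviation ivl_set :: "ivl \<Rightarrow> real set" where
  "ivl_set \<Delta> \<equiv> {fst \<Delta>..snd \<Delta>}"

context
  fixes m :: nat and \<rho> :: real and d :: "nat \<Rightarrow> real" and K :: "real set"
begin

definition net_points :: "nat \<Rightarrow> real set" where
  "net_points n = (\<Union>\<sigma>\<in>words m n. {word_map \<rho> d \<sigma> 0, word_map \<rho> d \<sigma> 1})"

definition net_intervals :: "nat \<Rightarrow> ivl set" where
  "net_intervals n =
     (if n = 0 then {(0, 1)}
      else {(a, b). a \<in> net_points n \<and> b \<in> net_points n \<and> a < b \<and>
              {a<..<b} \<inter> net_points n = {} \<and> {a<..<b} \<inter> K \<noteq> {}})"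

text \<open>The children, in level \<open>n + 1\<close>, of a net interval of level \<open>n\<close>.\<close>

definition net_children :: "nat \<Rightarrow> ivl \<Rightarrow> ivl set" where
  "net_children n \<Delta> = {\<Delta>' \<in> net_intervals (Suc n). ivl_set \<Delta>' \<subseteq> ivl_set \<Delta>}"

definition norm_length :: "nat \<Rightarrow> ivl \<Rightarrow> real" where
  "norm_length n \<Delta> = (snd \<Delta> - fst \<Delta>) / \<rho> ^ n"

definition neighbour_set :: "nat \<Rightarrow> ivl \<Rightarrow> real list" where
  "neighbour_set n \<Delta> =
     sorted_list_of_set
       {(fst \<Delta> - word_map \<rho> d \<sigma> 0) / \<rho> ^ n | \<sigma>.
          \<sigma> \<in> words m n \<and> ivl_set \<Delta> \<subseteq> word_map \<rho> d \<sigma> ` {0..1}}"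

text \<open>Positions count from 1; the interval of level 0, which has no parent, gets position 1.\<close>

definition net_position :: "nat \<Rightarrow> ivl \<Rightarrow> nat" where
  "net_position n \<Delta> =
     (case n of
        0 \<Rightarrow> 1
      | Suc k \<Rightarrow>
          card {\<Delta>'. (\<exists>P \<in> net_intervals k. \<Delta> \<in> net_children k P \<and> \<Delta>' \<in> net_children k P) \<and>
                     norm_length n \<Delta>' = norm_length n \<Delta> \<and> fst \<Delta>' \<le> fst \<Delta>})"

definition char_vector :: "nat \<Rightarrow> ivl \<Rightarrow> char_vec" where
  "char_vector n \<Delta> = (norm_length n \<Delta>, neighbour_set n \<Delta>, net_position n \<Delta>)"

definition red_vector :: "nat \<Rightarrow> ivl \<Rightarrow> red_vec" where
  "red_vector n \<Delta> = (norm_length n \<Delta>, neighbour_set n \<Delta>)"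

definition char_vectors :: "char_vec set" where
  "char_vectors = {char_vector n \<Delta> | n \<Delta>. \<Delta> \<in> net_intervals n}"

definition parent_vec :: "char_vec \<Rightarrow> char_vec \<Rightarrow> bool" where
  "parent_vec \<alpha> \<beta> \<longleftrightarrow>
     (\<exists>n. \<exists>\<Delta> \<in> net_intervals n. \<exists>\<Delta>' \<in> net_children n \<Delta>.
        char_vector n \<Delta> = \<alpha> \<and> char_vector (Suc n) \<Delta>' = \<beta>)"

definition admissible_path :: "char_vec list \<Rightarrow> bool" where
  "admissible_path p \<longleftrightarrow> p \<noteq> [] \<and> set p \<subseteq> char_vectors \<and> successively parent_vec p"

definition loop_class :: "char_vec set \<Rightarrow> bool" where
  "loop_class C \<longleftrightarrow>
     C \<noteq> {} \<and> C \<subseteq> char_vectors \<and>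
     (\<forall>\<alpha>\<in>C. \<forall>\<beta>\<in>C. \<exists>p. admissible_path p \<and> set p \<subseteq> C \<and> hd p = \<alpha> \<and> last p = \<beta>)"

definition essential_class :: "char_vec set \<Rightarrow> bool" where
  "essential_class C \<longleftrightarrow>
     loop_class C \<and> (\<forall>\<alpha>\<in>C. \<forall>\<beta>. parent_vec \<alpha> \<beta> \<longrightarrow> \<beta> \<in> C)"

text \<open>The number of children of the reduced characteristic vector \<open>\<gamma>\<close> having reduced characteristic
  vector \<open>\<gamma>'\<close>: the common value of this count over all net intervals, of any level, that realise
  \<open>\<gamma>\<close>.\<close>

definition child_count :: "red_vec \<Rightarrow> red_vec \<Rightarrow> nat" where
  "child_count \<gamma> \<gamma>' =
     (THE N. \<forall>n. \<forall>\<Delta> \<in> net_intervals n. red_vector n \<Delta> = \<gamma> \<longrightarrow>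
        card {\<Delta>' \<in> net_children n \<Delta>. red_vector (Suc n) \<Delta>' = \<gamma>'} = N)"

definition incidence_matrix :: "red_vec list \<Rightarrow> complex mat" where
  "incidence_matrix \<gamma>s =
     Matrix.mat (length \<gamma>s) (length \<gamma>s) (\<lambda>(j, k). of_nat (child_count (\<gamma>s ! j) (\<gamma>s ! k)))"

end

definition reduced_part :: "char_vec \<Rightarrow> red_vec" where
  "reduced_part \<alpha> = (fst \<alpha>, fst (snd \<alpha>))"

end

theory Submission
  imports Defs
begin

text \<open>Rescaling shows that the types (reduced characteristic vectors) of the children of a net interval
  depend only on its own type. The incidence matrix of the essential class is irreducible, so it
  has a positive eigenvector \<open>f\<close> for its spectral radius \<open>\<lambda>\<close>. Below a fixed net interval
  \<open>\<Delta>\<^sub>0\<close> of essential type, the weights \<open>f (type \<Delta>) / \<lambda> ^ k\<close> of the descendants \<open>\<Delta>\<close> of generation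
  \<open>k\<close> are additive under subdivision. As these descendants have length comparable to \<open>\<rho> ^ k\<close>,
  there are about \<open>\<lambda> ^ k\<close> of them, which bounds the dimension from above because \<open>\<Delta>\<^sub>0\<close> contains a
  similar copy of \<open>K\<close>; and a set of diameter \<open>\<rho> ^ j\<close> meets boundedly many descendants of
  generation \<open>j\<close>, so it carries weight at most a constant times \<open>\<lambda> ^ - j = \<rho> powr (s * j)\<close>
  with \<open>s = ln \<lambda> / \<bar>ln \<rho>\<bar>\<close>, which bounds it from below by the mass distribution argument.\<close>

section \<open>Nonnegative irreducible matrices\<close>

unbundle no vec_syntax

text \<open>The incidence matrix may be periodic, so no power of it need be positive and the number
  of descendants need not be asymptotic to a multiple of the k-th power of its spectral radius. An
  exact positive eigenvector avoids this: each generation multiplies the total weight by exactly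
  that radius, and the bounds on \<open>f\<close> turn weights into counts up to constants. The
  eigenvector comes from maximality. The moduli of the entries of an eigenvector for an eigenvalue
  of largest modulus r satisfy r x \<le> A x. A strict inequality at one coordinate would be spread
  to all of them by summing enough iterates, and would force a spectral radius above r. The weights
  are never extended to a measure on \<open>K\<close>. Compactness leaves finite covers, and for
  these all weights can be compared in one sufficiently late generation. Types forget the position
  among siblings, so an interval of essential type is not known to have its full characteristic
  vector in the essential class. Closure under children has to be transferred through the child
  counts.\<close>

definition real_mat :: "nat \<Rightarrow> (nat \<Rightarrow> nat \<Rightarrow> real) \<Rightarrow> complex mat" where
  "real_mat n a = Matrix.mat n n (\<lambda>(i, j). of_real (a i j))"

text \<open>Order arguments need real vectors, whereas \<open>spectral_radius\<close> belongs to
  complex matrices. Functions of the index also spare all dimension bookkeeping.\<close>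

definition mat_apply :: "nat \<Rightarrow> (nat \<Rightarrow> nat \<Rightarrow> real) \<Rightarrow> (nat \<Rightarrow> real) \<Rightarrow> nat \<Rightarrow> real" where
  "mat_apply n a u i = (\<Sum>j<n. a i j * u j)"

lemma real_mat_carrier [simp]: "real_mat n a \<in> carrier_mat n n"
  by (simp add: real_mat_def)

lemma real_mat_mult_vec:
  "real_mat n a *\<^sub>v Matrix.vec n (\<lambda>i. of_real (u i)) = Matrix.vec n (\<lambda>i. of_real (mat_apply n a u i))"
  by (rule eq_vecI)
    (auto simp: real_mat_def mat_apply_def scalar_prod_def lessThan_atLeast0 intro!: sum.cong)

lemma mat_apply_mono:
  assumes "\<And>i j. i < n \<Longrightarrow> j < n \<Longrightarrow> 0 \<le> a i j" and "\<And>j. j < n \<Longrightarrow> u j \<le> v j" and "i < n"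
  shows "mat_apply n a u i \<le> mat_apply n a v i"
  unfolding mat_apply_def using assms by (intro sum_mono mult_left_mono) auto

lemma mat_apply_cong:
  assumes "\<And>j. j < n \<Longrightarrow> u j = v j"
  shows "mat_apply n a u i = mat_apply n a v i"
  using assms by (simp add: mat_apply_def)

lemma mat_apply_scale: "mat_apply n a (\<lambda>j. c * u j) i = c * mat_apply n a u i"
  by (simp add: mat_apply_def sum_distrib_left mult_ac)

text \<open>Every \<open>u\<close> above \<open>c * y\<close> is allowed because, with A for the
  matrix, \<open>A ^\<^sub>m Suc k\<close> is \<open>A ^\<^sub>m k * A\<close>: the induction peels
  off the factor that acts first, and this replaces \<open>u\<close> by A u and \<open>c\<close> by
  \<open>c * q\<close>.\<close>

lemma real_mat_power_mult_vec_ge: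
  assumes nonneg: "\<And>i j. i < n \<Longrightarrow> j < n \<Longrightarrow> 0 \<le> a i j"
    and q: "0 \<le> q" and y: "\<And>i. i < n \<Longrightarrow> q * y i \<le> mat_apply n a y i"
    and c: "0 \<le> c" and u: "\<And>i. i < n \<Longrightarrow> c * y i \<le> u i"
  shows "\<exists>w. real_mat n a ^\<^sub>m k *\<^sub>v Matrix.vec n (\<lambda>i. of_real (u i)) = Matrix.vec n (\<lambda>i. of_real (w i))
             \<and> (\<forall>i<n. c * q ^ k * y i \<le> w i)"
  using c u
proof (induction k arbitrary: c u)
  case 0
  then show ?case by (intro exI[of _ u]) (auto simp: real_mat_def)
next
  case (Suc k)
  have "(c * q) * y i \<le> mat_apply n a u i" if "i < n" for i
  proof -
    have "(c * q) * y i \<le> c * mat_apply n a y i"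
      using Suc.prems(1) y[OF that] by (simp add: mult.assoc mult_left_mono)
    also have "\<dots> = mat_apply n a (\<lambda>j. c * y j) i" by (simp add: mat_apply_scale)
    also have "\<dots> \<le> mat_apply n a u i"
      using nonneg Suc.prems(2) that by (intro mat_apply_mono) auto
    finally show ?thesis .
  qed
  moreover have "0 \<le> c * q" using Suc.prems(1) q by simp
  ultimately obtain w where
    w: "real_mat n a ^\<^sub>m k *\<^sub>v Matrix.vec n (\<lambda>i. of_real (mat_apply n a u i)) = Matrix.vec n (\<lambda>i. of_real (w i))"
      "\<forall>i<n. c * q * q ^ k * y i \<le> w i"
    using Suc.IH[of "c * q" "mat_apply n a u"] by blast
  have "real_mat n a ^\<^sub>m Suc k *\<^sub>v Matrix.vec n (\<lambda>i. of_real (u i))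
      = real_mat n a ^\<^sub>m k *\<^sub>v (real_mat n a *\<^sub>v Matrix.vec n (\<lambda>i. of_real (u i)))"
    by (simp add: assoc_mult_mat_vec[of _ n n _ n] pow_carrier_mat)
  with w show ?case
    by (intro exI[of _ w]) (simp add: real_mat_mult_vec mult_ac)
qed

lemma spectral_radius_real_mat_nonneg:
  assumes "0 < n" shows "0 \<le> spectral_radius (real_mat n a)"
  using spectral_radius_mem_max(1)[OF real_mat_carrier assms, of a] by auto

lemma spectral_radius_real_mat_scale_le:
  assumes n: "0 < n" and c: "0 < c"
  shows "spectral_radius (real_mat n (\<lambda>i j. a i j / c)) \<le> spectral_radius (real_mat n a) / c"
proof -
  let ?B = "real_mat n (\<lambda>i j. a i j / c)" and ?A = "real_mat n a"
  obtain e where e: "eigenvalue ?B e" "spectral_radius ?B = norm e"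
    using spectral_radius_mem_max(1)[OF real_mat_carrier n, of "\<lambda>i j. a i j / c"]
    by (auto simp: spectrum_def)
  then obtain v where v: "v \<in> carrier_vec n" "v \<noteq> 0\<^sub>v n" "?B *\<^sub>v v = e \<cdot>\<^sub>v v"
    unfolding eigenvalue_def eigenvector_def by (auto simp: real_mat_def)
  have "?A *\<^sub>v v = of_real c \<cdot>\<^sub>v (?B *\<^sub>v v)"
    using c v(1)
    by (intro eq_vecI) (auto simp: real_mat_def scalar_prod_def sum_distrib_left intro!: sum.cong)
  then have "?A *\<^sub>v v = (of_real c * e) \<cdot>\<^sub>v v"
    using v(3) by (simp add: smult_smult_assoc)
  then have "eigenvalue ?A (of_real c * e)"
    unfolding eigenvalue_def eigenvector_def using v(1,2)
    by (intro exI[of _ v]) (auto simp: real_mat_def)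
  then have "norm (of_real c * e) \<le> spectral_radius ?A"
    by (intro spectral_radius_mem_max(2)[OF real_mat_carrier n]) (auto simp: spectrum_def)
  with c e(2) show ?thesis by (simp add: norm_mult field_simps)
qed

text \<open>Otherwise pick \<open>c\<close> strictly between the spectral radius and \<kappa>. Then
  A / c has spectral radius below 1, so its powers are bounded, yet their k-th one enlarges
  \<open>y\<close> by at least (\<kappa> / c)^k, which is unbounded at coordinate
  \<open>l\<close>.\<close>

lemma le_spectral_radius_if_superinvariant:
  assumes nonneg: "\<And>i j. i < n \<Longrightarrow> j < n \<Longrightarrow> 0 \<le> a i j"
    and y0: "\<And>i. i < n \<Longrightarrow> 0 \<le> y i" and l: "l < n" "0 < y l"
    and y: "\<And>i. i < n \<Longrightarrow> \<kappa> * y i \<le> mat_apply n a y i"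
  shows "\<kappa> \<le> spectral_radius (real_mat n a)"
proof (rule ccontr)
  let ?r = "spectral_radius (real_mat n a)"
  assume "\<not> ?thesis"
  then obtain c where c: "?r < c" "c < \<kappa>" using dense[of ?r \<kappa>] by auto
  have n: "0 < n" using l by simp
  have r0: "0 \<le> ?r" by (rule spectral_radius_real_mat_nonneg[OF n])
  with c have c0: "0 < c" by linarith
  define b where "b = (\<lambda>i j. a i j / c)"
  define q where "q = \<kappa> / c"
  have q: "1 < q" using c c0 by (simp add: q_def)
  have "spectral_radius (real_mat n b) \<le> ?r / c"
    unfolding b_def by (rule spectral_radius_real_mat_scale_le[OF n c0])
  also have "\<dots> < 1" using c c0 by simp
  finally obtain M where M: "\<And>k. norm_bound (real_mat n b ^\<^sub>m k) M"
    using spectral_radius_jnf_norm_bound_less_1_upper_triangular[OF real_mat_carrier] by blast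
  have b: "mat_apply n b u i = mat_apply n a u i / c" for u i
    by (simp add: mat_apply_def b_def sum_divide_distrib)
  have "q ^ k * y l \<le> (\<Sum>j<n. M * y j)" for k
  proof -
    let ?Y = "Matrix.vec n (\<lambda>i. complex_of_real (y i))"
    define P where "P = real_mat n b ^\<^sub>m k"
    have P: "P \<in> carrier_mat n n" by (simp add: P_def pow_carrier_mat)
    have "q * y i \<le> mat_apply n b y i" if "i < n" for i
      using y[OF that] c0 by (simp add: b q_def field_simps)
    moreover have "0 \<le> b i j" if "i < n" "j < n" for i j
      using nonneg[OF that] c0 by (simp add: b_def)
    ultimately obtain w where
      w: "P *\<^sub>v ?Y = Matrix.vec n (\<lambda>i. of_real (w i))" "\<forall>i<n. 1 * q ^ k * y i \<le> w i"
      using real_mat_power_mult_vec_ge[of n b q y 1 y k] q unfolding P_def by auto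
    have "q ^ k * y l \<le> w l" using w(2) l by simp
    also have "\<dots> \<le> norm ((P *\<^sub>v ?Y) $ l)" using w(1) l by simp
    also have "(P *\<^sub>v ?Y) $ l = (\<Sum>j<n. P $$ (l, j) * of_real (y j))"
      using P l by (auto simp: scalar_prod_def lessThan_atLeast0 intro!: sum.cong)
    also have "norm \<dots> \<le> (\<Sum>j<n. M * y j)"
    proof (intro sum_norm_le)
      fix j assume j: "j \<in> {..<n}"
      have "norm (P $$ (l, j)) \<le> M"
        using M[of k] P j l unfolding norm_bound_def P_def[symmetric] by auto
      then show "norm (P $$ (l, j) * of_real (y j)) \<le> M * y j"
        using y0 j by (simp add: norm_mult mult_right_mono)
    qed
    finally show ?thesis .
  qed
  moreover obtain k where "(\<Sum>j<n. M * y j) / y l < q ^ k"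
    using real_arch_pow[OF q] by blast
  ultimately show False using l(2) by (meson divide_less_eq not_less)
qed

section \<open>Positivity of iterates and the Perron vector\<close>

lemma mat_apply_funpow_nonneg:
  assumes nonneg: "\<And>i j. i < n \<Longrightarrow> j < n \<Longrightarrow> 0 \<le> a i j"
    and u: "\<And>i. i < n \<Longrightarrow> 0 \<le> u i" and "i < n"
  shows "0 \<le> (mat_apply n a ^^ k) u i"
  using \<open>i < n\<close>
proof (induction k arbitrary: i)
  case (Suc k)
  then show ?case using nonneg by (auto simp: mat_apply_def[of n a "(mat_apply n a ^^ k) u"] intro!: sum_nonneg)
qed (use u in simp)

text \<open>Positivity travels backwards along edges: if \<open>0 < a i j\<close>, one more
  application moves it from coordinate \<open>j\<close> to coordinate \<open>i\<close>. The exponent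
  found depends on \<open>i\<close>.\<close>

lemma mat_apply_funpow_pos:
  assumes nonneg: "\<And>i j. i < n \<Longrightarrow> j < n \<Longrightarrow> 0 \<le> a i j"
    and u: "\<And>i. i < n \<Longrightarrow> 0 \<le> u i" and "l < n" "0 < u l"
    and path: "(i, l) \<in> {(i, j). i < n \<and> j < n \<and> 0 < a i j}\<^sup>*"
  shows "\<exists>k. 0 < (mat_apply n a ^^ k) u i"
  using path
proof (induction rule: converse_rtrancl_induct)
  case base
  show ?case using \<open>0 < u l\<close> by (intro exI[of _ 0]) simp
next
  case (step i j)
  then obtain k where k: "0 < (mat_apply n a ^^ k) u j" by blast
  have ij: "i < n" "j < n" "0 < a i j" using step by auto
  have "0 < a i j * (mat_apply n a ^^ k) u j" using ij k by simp
  also have "\<dots> \<le> mat_apply n a ((mat_apply n a ^^ k) u) i"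
    unfolding mat_apply_def[of n a "(mat_apply n a ^^ k) u"]
    using ij nonneg mat_apply_funpow_nonneg[of n a u, OF nonneg u]
    by (intro member_le_sum) auto
  finally show ?case by (intro exI[of _ "Suc k"]) simp
qed

text \<open>For a periodic matrix the coordinates may have no exponent in common. Summing over all
  exponents up to a common bound still gives positivity everywhere, since no term is
  negative.\<close>

lemma exists_uniform_pos_sum:
  assumes nonneg: "\<And>i k. i < n \<Longrightarrow> (0::real) \<le> f k i"
    and "\<And>i. i < n \<Longrightarrow> \<exists>k. 0 < f k i"
  shows "\<exists>N. \<forall>N'\<ge>N. \<forall>i<(n::nat). 0 < (\<Sum>k\<le>N'. f (k::nat) i)"
proof -
  obtain K where K: "\<And>i. i < n \<Longrightarrow> 0 < f (K i) i" using assms(2) by metis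
  have "0 < (\<Sum>k\<le>N'. f k i)" if "i < n" "(\<Sum>i<n. K i) \<le> N'" for i N'
  proof (rule sum_pos2[where i = "K i"])
    have "K i \<le> (\<Sum>i<n. K i)" using that by (intro member_le_sum) auto
    then show "K i \<in> {..N'}" using that by simp
  qed (use K nonneg that in auto)
  then show ?thesis by blast
qed

lemma mat_apply_funpow_sum_pos:
  assumes nonneg: "\<And>i j. i < n \<Longrightarrow> j < n \<Longrightarrow> 0 \<le> a i j"
    and irred: "\<And>i j. i < n \<Longrightarrow> j < n \<Longrightarrow> (i, j) \<in> {(i, j). i < n \<and> j < n \<and> 0 < a i j}\<^sup>*"
    and u: "\<And>i. i < n \<Longrightarrow> 0 \<le> u i" and l: "l < n" "0 < u l"
  shows "\<exists>N. \<forall>N'\<ge>N. \<forall>i<n. 0 < (\<Sum>k\<le>N'. (mat_apply n a ^^ k) u i)"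
proof (rule exists_uniform_pos_sum)
  show "0 \<le> (mat_apply n a ^^ k) u i" if "i < n" for i k
    using mat_apply_funpow_nonneg[of n a u] nonneg u that by blast
  show "\<exists>k. 0 < (mat_apply n a ^^ k) u i" if "i < n" for i
    using mat_apply_funpow_pos[of n a u l i] nonneg u l irred that by blast
qed

lemma mat_apply_diff: "mat_apply n a (\<lambda>j. u j - v j) i = mat_apply n a u i - mat_apply n a v i"
  by (simp add: mat_apply_def sum_subtractf algebra_simps)

lemma mat_apply_sum: "mat_apply n a (\<lambda>j. \<Sum>k\<in>S. f k j) i = (\<Sum>k\<in>S. mat_apply n a (f k) i)"
  unfolding mat_apply_def sum_distrib_left by (rule sum.swap)

text \<open>Powers of T commute with T - c. Hence summing the iterates of the defect T x - c x gives
  the defect of the summed iterates of \<open>x\<close>.\<close>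

lemma mat_apply_funpow_linear:
  "(mat_apply n a ^^ k) (\<lambda>j. mat_apply n a x j - c * x j) i
     = (mat_apply n a ^^ Suc k) x i - c * (mat_apply n a ^^ k) x i"
proof (induction k arbitrary: i)
  case (Suc k)
  then have "(mat_apply n a ^^ k) (\<lambda>j. mat_apply n a x j - c * x j)
    = (\<lambda>i. (mat_apply n a ^^ Suc k) x i - c * (mat_apply n a ^^ k) x i)" by blast
  then show ?case by (simp add: mat_apply_diff mat_apply_scale)
qed simp

text \<open>Take an eigenvector for an eigenvalue of largest modulus and pass to the moduli of its
  entries; the triangle inequality turns the eigenvalue equation into the inequality.\<close>

lemma exists_subinvariant_vector:
  assumes n: "0 < n" and nonneg: "\<And>i j. i < n \<Longrightarrow> j < n \<Longrightarrow> 0 \<le> a i j"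
  shows "\<exists>x. (\<forall>i<n. 0 \<le> x i) \<and> (\<exists>i<n. 0 < x i) \<and>
             (\<forall>i<n. spectral_radius (real_mat n a) * x i \<le> mat_apply n a x i)"
proof -
  let ?A = "real_mat n a"
  obtain e where e: "eigenvalue ?A e" "spectral_radius ?A = norm e"
    using spectral_radius_mem_max(1)[OF real_mat_carrier n, of a] by (auto simp: spectrum_def)
  then obtain v where v: "v \<in> carrier_vec n" "v \<noteq> 0\<^sub>v n" "?A *\<^sub>v v = e \<cdot>\<^sub>v v"
    unfolding eigenvalue_def eigenvector_def by (auto simp: real_mat_def)
  obtain i where i: "i < n" "v $ i \<noteq> 0"
    using v(1,2) by (metis carrier_vecD eq_vecI index_zero_vec)
  have "norm e * norm (v $ i) \<le> mat_apply n a (\<lambda>j. norm (v $ j)) i" if "i < n" for i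
  proof -
    have "e * v $ i = (?A *\<^sub>v v) $ i" using v that by auto
    also have "\<dots> = (\<Sum>j<n. of_real (a i j) * v $ j)"
      using v(1) that
      by (auto simp: real_mat_def scalar_prod_def lessThan_atLeast0 intro!: sum.cong)
    finally have "norm e * norm (v $ i) = norm (\<Sum>j<n. of_real (a i j) * v $ j)"
      by (metis norm_mult)
    also have "\<dots> \<le> (\<Sum>j<n. a i j * norm (v $ j))"
      using nonneg that by (intro sum_norm_le) (auto simp: norm_mult)
    finally show ?thesis by (simp add: mat_apply_def)
  qed
  with i e(2) show ?thesis by (intro exI[of _ "\<lambda>j. norm (v $ j)"]) auto
qed

theorem perron_frobenius_vector:
  assumes n: "0 < n" and nonneg: "\<And>i j. i < n \<Longrightarrow> j < n \<Longrightarrow> 0 \<le> a i j"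
    and irred: "\<And>i j. i < n \<Longrightarrow> j < n \<Longrightarrow> (i, j) \<in> {(i, j). i < n \<and> j < n \<and> 0 < a i j}\<^sup>*"
  shows "\<exists>x. (\<forall>i<n. 0 < x i) \<and> (\<forall>i<n. mat_apply n a x i = spectral_radius (real_mat n a) * x i)"
proof -
  define r where "r = spectral_radius (real_mat n a)"
  have r0: "0 \<le> r" unfolding r_def by (rule spectral_radius_real_mat_nonneg[OF n])
  let ?T = "mat_apply n a"
  obtain x l where x: "\<And>i. i < n \<Longrightarrow> 0 \<le> x i" "l < n" "0 < x l" "\<And>i. i < n \<Longrightarrow> r * x i \<le> ?T x i"
    using exists_subinvariant_vector[of n a] n nonneg unfolding r_def by blast
  define g where "g = (\<lambda>i. ?T x i - r * x i)"
  have g: "0 \<le> g i" if "i < n" for i using x(4)[OF that] by (simp add: g_def)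
  obtain N where N: "\<forall>N'\<ge>N. \<forall>i<n. 0 < (\<Sum>k\<le>N'. (?T ^^ k) x i)"
    using mat_apply_funpow_sum_pos[of n a x l] nonneg irred x by blast
  \<comment> \<open>A positive defect at one coordinate becomes positive at all of them under the
    sum of iterates. This yields T y \<ge> (r + \<delta>) y with y positive, against the maximality
    of r.\<close>
  have g0: "g i = 0" if i: "i < n" for i
  proof (rule ccontr)
    assume "g i \<noteq> 0"
    with g[OF i] have gi: "0 < g i" by linarith
    obtain M where M: "\<forall>M'\<ge>M. \<forall>i<n. 0 < (\<Sum>k\<le>M'. (?T ^^ k) g i)"
      using mat_apply_funpow_sum_pos[of n a g i] nonneg irred g i gi by blast
    \<comment> \<open>The bound \<open>max M N\<close> serves \<open>x\<close> and \<open>g\<close>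
      at once, because both positivity statements persist for larger bounds.\<close>
    define y where "y = (\<lambda>i. \<Sum>k\<le>max M N. (?T ^^ k) x i)"
    define h where "h = (\<lambda>i. \<Sum>k\<le>max M N. (?T ^^ k) g i)"
    have y: "0 < y i" and h: "0 < h i" if "i < n" for i
      using M N that unfolding y_def h_def by auto
    have hy: "h i = ?T y i - r * y i" for i
      unfolding h_def y_def mat_apply_sum g_def mat_apply_funpow_linear
      by (simp add: sum_subtractf sum_distrib_left)
    define \<delta> where "\<delta> = Min ((\<lambda>i. h i / y i) ` {..<n})"
    have "0 < \<delta>" unfolding \<delta>_def using n y h by (subst Min_gr_iff) auto
    have "(r + \<delta>) * y i \<le> ?T y i" if i: "i < n" for i
    proof -
      have "\<delta> \<le> h i / y i" unfolding \<delta>_def using i by (intro Min_le) auto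
      then have "\<delta> * y i \<le> h i" using y[OF i] by (simp add: field_simps)
      then show ?thesis using hy[of i] by (simp add: algebra_simps)
    qed
    then have "r + \<delta> \<le> r" using nonneg y n unfolding r_def
      by (intro le_spectral_radius_if_superinvariant[of n a y 0]) (auto simp: less_imp_le)
    with \<open>0 < \<delta>\<close> show False by simp
  qed
  then have eig: "?T x i = r * x i" if "i < n" for i using that by (simp add: g_def)
  have pow: "(?T ^^ k) x i = r ^ k * x i" if "i < n" for k i
    using that
  proof (induction k arbitrary: i)
    case (Suc k)
    then have "?T ((?T ^^ k) x) i = ?T (\<lambda>j. r ^ k * x j) i"
      by (intro mat_apply_cong) auto
    with Suc.prems eig show ?case by (simp add: mat_apply_scale)
  qed simp
  \<comment> \<open>On an eigenvector the sum of iterates is a multiple of \<open>x i\<close>, so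
    its positivity forbids \<open>x i = 0\<close>.\<close>
  have "0 < x i" if i: "i < n" for i
  proof -
    have "(\<Sum>k\<le>N. (?T ^^ k) x i) = (\<Sum>k\<le>N. r ^ k * x i)" by (simp only: pow[OF i])
    moreover have "0 < (\<Sum>k\<le>N. (?T ^^ k) x i)" using N i by blast
    ultimately show ?thesis using x(1)[OF i] by (cases "x i = 0") auto
  qed
  with eig show ?thesis unfolding r_def by blast
qed

section \<open>Hausdorff measure and dimension\<close>

lemma hausdorff_measure_eq_0I:
  assumes "0 < s"
    and cover: "\<And>\<delta> \<epsilon>. 0 < \<delta> \<Longrightarrow> 0 < \<epsilon> \<Longrightarrow> \<exists>F. finite F \<and> A \<subseteq> \<Union>F \<and>
           (\<forall>U\<in>F. bounded U \<and> diameter U \<le> \<delta>) \<and> (\<Sum>U\<in>F. diameter U powr s) \<le> \<epsilon>"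
  shows "hausdorff_measure s A = 0"
proof -
  have bound: "hausdorff_content \<delta> s A \<le> 0 + ennreal \<epsilon>" if \<delta>: "0 < \<delta>" and \<epsilon>: "0 < \<epsilon>" for \<delta> \<epsilon>
  proof -
    obtain F where F: "finite F" "A \<subseteq> \<Union>F" "\<forall>U\<in>F. bounded U \<and> diameter U \<le> \<delta>"
        "(\<Sum>U\<in>F. diameter U powr s) \<le> \<epsilon>"
      using cover[OF \<delta> \<epsilon>] by blast
    obtain f and n :: nat where f: "F = f ` {i. i < n}" "inj_on f {i. i < n}"
      using finite_imp_nat_seg_image_inj_on[OF F(1)] by blast
    \<comment> \<open>Padding a finite cover to a sequence is free, since the gauge of the empty set
      is 0.\<close>
    define U where "U = (\<lambda>i. if i < n then f i else {})"
    have "A \<subseteq> (\<Union>i. U i)"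
    proof
      fix x assume "x \<in> A"
      then obtain i where "i < n" "x \<in> f i" using F(2) f(1) by auto
      then show "x \<in> (\<Union>i. U i)" by (auto simp: U_def intro!: exI[of _ i])
    qed
    moreover have "\<forall>i. bounded (U i) \<and> diameter (U i) \<le> \<delta>"
      using F(3) f(1) \<delta> by (auto simp: U_def)
    ultimately have "hausdorff_content \<delta> s A \<le> (\<Sum>i. hausdorff_gauge s (U i))"
      unfolding hausdorff_content_def by (intro INF_lower) auto
    also have "\<dots> = (\<Sum>i<n. hausdorff_gauge s (U i))"
      by (intro suminf_finite) (auto simp: U_def hausdorff_gauge_def)
    also have "\<dots> \<le> (\<Sum>i<n. ennreal (diameter (f i) powr s))"
      using \<open>0 < s\<close> by (intro sum_mono) (auto simp: hausdorff_gauge_def U_def)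
    also have "\<dots> = ennreal (\<Sum>i<n. diameter (f i) powr s)" by simp
    also have "(\<Sum>i<n. diameter (f i) powr s) = (\<Sum>U\<in>F. diameter U powr s)"
      using f by (simp add: sum.reindex lessThan_def)
    finally show ?thesis using F(4) by (auto intro: order_trans ennreal_leI)
  qed
  have "hausdorff_content \<delta> s A \<le> 0" if "0 < \<delta>" for \<delta>
    by (rule ennreal_le_epsilon) (rule bound[OF that])
  then have "hausdorff_measure s A \<le> 0"
    unfolding hausdorff_measure_def by (intro SUP_least) auto
  then show ?thesis by simp
qed

text \<open>For diameters at most 1 a smaller exponent gives a larger power, and at
  \<open>t = 0\<close> the gauge 1 of a nonempty set dominates as well. A mass bound at exponent
  \<open>s\<close> thus carries over to all smaller exponents.\<close>

lemma diameter_powr_le_hausdorff_gauge: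
  assumes "diameter U \<le> 1" "0 \<le> t" "t \<le> s" "0 < s" "bounded U"
  shows "ennreal (diameter U powr s) \<le> hausdorff_gauge t U"
proof (cases "U = {} \<or> t = 0")
  case True
  then show ?thesis using assms powr_mono2[of s "diameter U" 1] diameter_ge_0[of U]
    by (auto simp: hausdorff_gauge_def)
next
  case False
  then show ?thesis using assms powr_mono'[of t s "diameter U"] diameter_ge_0[of U]
    by (auto simp: hausdorff_gauge_def intro: ennreal_leI)
qed

text \<open>Room for thickening a set of diameter \<open>D\<close> to an open one at little cost.
  The reason is right continuity at 0 of e \<mapsto> (D + 2 e)^s, where \<open>0 < s\<close> secures
  the case \<open>D = 0\<close>.\<close>

lemma exists_enlargement:
  fixes D s \<delta> \<eta> :: real
  assumes "0 \<le> D" "D < \<delta>" "0 < \<eta>" "0 < s"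
  shows "\<exists>e>0. D + 2 * e \<le> \<delta> \<and> (D + 2 * e) powr s \<le> D powr s + \<eta>"
proof -
  have "((\<lambda>e. (D + 2 * e) powr s) \<longlongrightarrow> (D + 2 * 0) powr s) (at_right 0)"
    using assms by (intro tendsto_powr' tendsto_intros)
      (auto simp: eventually_at_right_less eventually_at_filter)
  then have "\<forall>\<^sub>F e in at_right 0. (D + 2 * e) powr s < D powr s + \<eta>"
    using assms by (intro order_tendstoD(2)[where y = "(D + 2 * 0) powr s"]) auto
  moreover have "\<forall>\<^sub>F e in at_right 0. e < (\<delta> - D) / 2"
    using assms by (intro eventually_at_right_less eventually_at_rightI[of 0 "(\<delta> - D) / 2"]) auto
  moreover have "\<forall>\<^sub>F e in at_right (0::real). 0 < e" by (rule eventually_at_right_less)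
  ultimately have "\<forall>\<^sub>F e in at_right 0. 0 < e \<and> D + 2 * e \<le> \<delta> \<and> (D + 2 * e) powr s \<le> D powr s + \<eta>"
    by eventually_elim auto
  then show ?thesis using eventually_happens[of _ "at_right (0::real)"] by fastforce
qed

text \<open>Compactness reduces arbitrary countable covers to finite open ones.\<close>

lemma hausdorff_measure_nonzeroI:
  fixes A :: "'a::metric_space set"
  assumes "compact A" and "0 < c" and "0 < \<delta>\<^sub>0" and "0 \<le> t" "t \<le> s" "0 < s"
    and mass: "\<And>I (V :: nat \<Rightarrow> 'a set) r. finite I \<Longrightarrow> A \<subseteq> (\<Union>i\<in>I. V i) \<Longrightarrow>
       (\<And>i. i \<in> I \<Longrightarrow> 0 < r i \<and> r i \<le> \<delta>\<^sub>0) \<Longrightarrow>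
       (\<And>i x y. i \<in> I \<Longrightarrow> x \<in> V i \<Longrightarrow> y \<in> V i \<Longrightarrow> dist x y \<le> r i) \<Longrightarrow>
       c \<le> (\<Sum>i\<in>I. r i powr s)"
  shows "hausdorff_measure t A \<noteq> 0"
proof -
  \<comment> \<open>Staying below \<open>\<delta>\<^sub>0\<close> leaves room for thickening the
    sets; staying below 1 permits the comparison of exponents.\<close>
  define \<delta> where "\<delta> = min 1 (\<delta>\<^sub>0 / 2)"
  have \<delta>: "0 < \<delta>" "\<delta> \<le> 1" "\<delta> < \<delta>\<^sub>0" using \<open>0 < \<delta>\<^sub>0\<close> by (auto simp: \<delta>_def min_def)
  have "ennreal (c / 2) \<le> hausdorff_content \<delta> t A"
    unfolding hausdorff_content_def
  proof (intro INF_greatest)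
    fix U :: "nat \<Rightarrow> 'a set"
    assume "U \<in> {U. A \<subseteq> (\<Union>i. U i) \<and> (\<forall>i. bounded (U i) \<and> diameter (U i) \<le> \<delta>)}"
    then have U: "A \<subseteq> (\<Union>i. U i)" "\<And>i. bounded (U i)" "\<And>i. diameter (U i) \<le> \<delta>" by auto
    have U0: "0 \<le> diameter (U i)" for i using U(2) by (rule diameter_ge_0)
    \<comment> \<open>The permitted losses halve with each index and add up to at most c / 2, so
      half of the mass bound survives.\<close>
    have "\<forall>i. \<exists>e. 0 < e \<and> diameter (U i) + 2 * e \<le> \<delta>\<^sub>0 \<and>
        (diameter (U i) + 2 * e) powr s \<le> diameter (U i) powr s + c / 2 * (1 / 2) ^ Suc i"
    proof
      fix i
      show "\<exists>e. 0 < e \<and> diameter (U i) + 2 * e \<le> \<delta>\<^sub>0 \<and>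
          (diameter (U i) + 2 * e) powr s \<le> diameter (U i) powr s + c / 2 * (1 / 2) ^ Suc i"
        using U0[of i] U(3)[of i] \<delta> \<open>0 < c\<close> \<open>0 < s\<close> by (intro exists_enlargement) auto
    qed
    from choice[OF this] obtain e where "\<forall>i. 0 < e i \<and> diameter (U i) + 2 * e i \<le> \<delta>\<^sub>0 \<and>
        (diameter (U i) + 2 * e i) powr s \<le> diameter (U i) powr s + c / 2 * (1 / 2) ^ Suc i" ..
    then have e: "0 < e i" "diameter (U i) + 2 * e i \<le> \<delta>\<^sub>0"
      "(diameter (U i) + 2 * e i) powr s \<le> diameter (U i) powr s + c / 2 * (1 / 2) ^ Suc i" for i
      by (auto dest!: spec[of _ i])
    define V where "V = (\<lambda>i. \<Union>x\<in>U i. ball x (e i))"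
    have "U i \<subseteq> V i" for i using e(1)[of i] by (auto simp: V_def)
    with U(1) have "A \<subseteq> (\<Union>i. V i)" by blast
    moreover have "open (V i)" for i by (auto simp: V_def)
    ultimately obtain I where I: "finite I" "A \<subseteq> (\<Union>i\<in>I. V i)"
      using compactE_image[OF \<open>compact A\<close>, of UNIV V] by metis
    have "dist x y \<le> diameter (U i) + 2 * e i" if xy: "x \<in> V i" "y \<in> V i" for i x y
    proof -
      obtain x' where x': "x' \<in> U i" "dist x' x < e i" using xy(1) by (auto simp: V_def)
      obtain y' where y': "y' \<in> U i" "dist y' y < e i" using xy(2) by (auto simp: V_def)
      have "dist x' y' \<le> diameter (U i)"
        using U(2) x' y' by (intro diameter_bounded_bound) auto
      moreover have "dist x y \<le> dist x' x + dist x' y' + dist y' y"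
        using dist_triangle[of x y x'] dist_triangle[of x' y y'] by (simp add: dist_commute)
      ultimately show ?thesis using x' y' by linarith
    qed
    moreover have "0 < diameter (U i) + 2 * e i" for i using U0[of i] e(1)[of i] by linarith
    ultimately have "c \<le> (\<Sum>i\<in>I. (diameter (U i) + 2 * e i) powr s)"
      using I e(2) by (intro mass[of I V]) blast+
    also have "\<dots> \<le> (\<Sum>i\<in>I. diameter (U i) powr s + c / 2 * (1 / 2) ^ Suc i)"
      by (intro sum_mono e)
    also have "\<dots> = (\<Sum>i\<in>I. diameter (U i) powr s) + c / 2 * (\<Sum>i\<in>I. (1 / 2) ^ Suc i)"
      by (simp add: sum.distrib sum_distrib_left)
    also have "(\<Sum>i\<in>I. (1 / 2 :: real) ^ Suc i) \<le> 1"
      using sum_le_suminf[OF sums_summable[OF power_half_series] I(1)] sums_unique[OF power_half_series]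
      by simp
    finally have "c / 2 \<le> (\<Sum>i\<in>I. diameter (U i) powr s)" using \<open>0 < c\<close> by simp
    then have "ennreal (c / 2) \<le> (\<Sum>i\<in>I. ennreal (diameter (U i) powr s))"
      by (simp add: ennreal_leI)
    also have "\<dots> \<le> (\<Sum>i\<in>I. hausdorff_gauge t (U i))"
      by (intro sum_mono diameter_powr_le_hausdorff_gauge order_trans[OF U(3) \<delta>(2)] U(2) assms(4-6))
    also have "\<dots> \<le> (\<Sum>i. hausdorff_gauge t (U i))"
      using I(1) by (intro sum_le_suminf) auto
    finally show "ennreal (c / 2) \<le> (\<Sum>i. hausdorff_gauge t (U i))" .
  qed
  also have "\<dots> \<le> hausdorff_measure t A"
    unfolding hausdorff_measure_def using \<delta> by (intro SUP_upper) auto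
  finally show ?thesis using \<open>0 < c\<close> by (auto simp: ennreal_eq_0_iff)
qed

lemma hausdorff_dim_eqI:
  assumes "0 \<le> s" and "\<And>t. s < t \<Longrightarrow> hausdorff_measure t A = 0"
    and "\<And>t. 0 \<le> t \<Longrightarrow> t < s \<Longrightarrow> hausdorff_measure t A \<noteq> 0"
  shows "hausdorff_dim A = ereal s"
proof (rule antisym)
  show "ereal s \<le> hausdorff_dim A"
    unfolding hausdorff_dim_def using assms(3) by (intro INF_greatest) (auto simp: not_less[symmetric])
  have le: "hausdorff_dim A \<le> ereal t" if "s < t" for t
    unfolding hausdorff_dim_def using assms(1,2) that by (intro INF_lower) auto
  show "hausdorff_dim A \<le> ereal s"
  proof (rule ereal_le_epsilon2)
    fix e :: real assume "0 < e"
    then show "hausdorff_dim A \<le> ereal s + ereal e" using le[of "s + e"] by simp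
  qed
qed

section \<open>Net intervals and their children\<close>

lemma word_map_Nil: "word_map \<rho> d [] = (\<lambda>x. x)"
  by (simp add: word_map_def id_def)

lemma word_map_Cons: "word_map \<rho> d (i # \<sigma>) x = ifs_map \<rho> d i (word_map \<rho> d \<sigma> x)"
  by (simp add: word_map_def)

lemma word_map_snoc: "word_map \<rho> d (\<sigma> @ [j]) x = word_map \<rho> d \<sigma> (\<rho> * x + d j)"
  by (induction \<sigma>) (simp_all add: word_map_Nil word_map_Cons ifs_map_def)

lemma word_map_affine: "word_map \<rho> d \<sigma> x = \<rho> ^ length \<sigma> * x + word_map \<rho> d \<sigma> 0"
proof (induction \<sigma>)
  case (Cons i \<sigma>)
  show ?case unfolding word_map_Cons ifs_map_def by (subst Cons.IH) (simp add: algebra_simps)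
qed (simp add: word_map_Nil)

lemma diff_divide_eq_iff: "c \<noteq> 0 \<Longrightarrow> (x - a) / c = t \<longleftrightarrow> x = a + c * t" for x :: real
  by (auto simp: field_simps)

lemma finite_words [simp]: "finite (words m n)"
  using finite_lists_length_eq[of "{0..m}" n] by (simp add: words_def conj_commute)

lemma words_0: "words m 0 = {[]}"
  by (auto simp: words_def)

lemma words_Suc_iff: "\<tau> \<in> words m (Suc n) \<longleftrightarrow> (\<exists>\<sigma> j. \<tau> = \<sigma> @ [j] \<and> \<sigma> \<in> words m n \<and> j \<le> m)"
  by (cases \<tau> rule: rev_exhaust) (auto simp: words_def)

lemma length_words: "\<sigma> \<in> words m n \<Longrightarrow> length \<sigma> = n"
  by (simp add: words_def)

section \<open>The self-similar set and its copies\<close>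

locale unit_ifs =
  fixes m :: nat and \<rho> :: real and d :: "nat \<Rightarrow> real" and K :: "real set"
  assumes rho: "0 < \<rho>" "\<rho> < 1"
    and d0: "d 0 = 0"
    and compact_K: "compact K" and K_ne: "K \<noteq> {}"
    and K_inv: "K = (\<Union>j\<in>{0..m}. ifs_map \<rho> d j ` K)"
    and hull_K: "convex hull K = {0..1}"
begin

abbreviation "Wd \<equiv> words m"
abbreviation "S \<equiv> word_map \<rho> d"
abbreviation "NP \<equiv> net_points m \<rho> d"
abbreviation "NI \<equiv> net_intervals m \<rho> d K"
abbreviation "CH \<equiv> net_children m \<rho> d K"
abbreviation "red \<equiv> red_vector m \<rho> d"

lemma rho_nonzero [simp]: "\<rho> \<noteq> 0"
  using rho by simp

lemma K_subset: "K \<subseteq> {0..1}"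
  using hull_subset[of K convex] hull_K by auto

lemma zero_in_K: "0 \<in> K"
proof -
  obtain s where s: "s \<in> K" "\<And>t. t \<in> K \<Longrightarrow> s \<le> t"
    using compact_attains_inf[OF compact_K K_ne] by blast
  then have "convex hull K \<subseteq> {s..}" by (intro hull_minimal) auto
  then have "s \<le> 0" using hull_K by auto
  with s(1) K_subset show ?thesis by (cases "s = 0") auto
qed

lemma one_in_K: "1 \<in> K"
proof -
  obtain s where s: "s \<in> K" "\<And>t. t \<in> K \<Longrightarrow> t \<le> s"
    using compact_attains_sup[OF compact_K K_ne] by blast
  then have "convex hull K \<subseteq> {..s}" by (intro hull_minimal) auto
  then have "1 \<le> s" using hull_K by auto
  with s(1) K_subset show ?thesis by (cases "s = 1") auto
qed

lemma ifs_map_in_K: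
  assumes "j \<le> m" "x \<in> K" shows "\<rho> * x + d j \<in> K"
proof -
  have "\<rho> * x + d j \<in> (\<Union>j\<in>{0..m}. ifs_map \<rho> d j ` K)" using assms by (auto simp: ifs_map_def)
  then show ?thesis by (rule subsetD[OF equalityD2[OF K_inv]])
qed

lemma digit_bounds:
  assumes "j \<le> m" shows "0 \<le> d j" "\<rho> + d j \<le> 1"
  using ifs_map_in_K[OF assms zero_in_K] ifs_map_in_K[OF assms one_in_K] K_subset by auto

text \<open>Counterpart of \<open>d 0 = 0\<close> at the right end: appending this digit makes the
  right endpoint of a copy an endpoint again one level later.\<close>

lemma exists_top_digit: "\<exists>j\<le>m. \<rho> + d j = 1"
proof -
  have "1 \<in> (\<Union>j\<in>{0..m}. ifs_map \<rho> d j ` K)" using one_in_K by (rule subsetD[OF equalityD1[OF K_inv]])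
  then obtain j x where "j \<le> m" "x \<in> K" "1 = \<rho> * x + d j" by (auto simp: ifs_map_def)
  moreover from this have "\<rho> * x \<le> \<rho>" using K_subset rho by (auto intro: mult_left_le)
  ultimately show ?thesis using digit_bounds(2)[of j] by (intro exI[of _ j]) simp
qed

lemma digit_interval:
  assumes "j \<le> m" "0 \<le> x" "x \<le> 1" shows "0 \<le> \<rho> * x + d j" "\<rho> * x + d j \<le> 1"
proof -
  have "0 \<le> \<rho> * x" "\<rho> * x \<le> \<rho>" using assms rho by (auto intro: mult_left_le)
  then show "0 \<le> \<rho> * x + d j" "\<rho> * x + d j \<le> 1" using digit_bounds[OF assms(1)] by auto
qed

lemma S_eq: "\<sigma> \<in> Wd n \<Longrightarrow> S \<sigma> x = S \<sigma> 0 + \<rho> ^ n * x"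
  using word_map_affine[of \<rho> d \<sigma> x] by (simp add: length_words)

lemma K_words: "K = (\<Union>\<sigma>\<in>Wd n. S \<sigma> ` K)"
proof (induction n)
  case (Suc n)
  show ?case
  proof (rule Set.set_eqI, rule iffI)
    fix x assume "x \<in> K"
    then obtain \<sigma> y where \<sigma>: "\<sigma> \<in> Wd n" "y \<in> K" "x = S \<sigma> y"
      using subsetD[OF equalityD1[OF Suc.IH] \<open>x \<in> K\<close>] by auto
    then obtain j z where j: "j \<le> m" "z \<in> K" "y = \<rho> * z + d j"
      using subsetD[OF equalityD1[OF K_inv] \<sigma>(2)] by (auto simp: ifs_map_def)
    have "x = S (\<sigma> @ [j]) z" using \<sigma>(3) j(3) by (simp add: word_map_snoc)
    moreover have "\<sigma> @ [j] \<in> Wd (Suc n)" using \<sigma>(1) j(1) by (simp add: words_Suc_iff)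
    ultimately show "x \<in> (\<Union>\<tau>\<in>Wd (Suc n). S \<tau> ` K)" using j(2) by auto
  next
    fix x assume "x \<in> (\<Union>\<tau>\<in>Wd (Suc n). S \<tau> ` K)"
    then obtain \<sigma> j z where \<sigma>: "\<sigma> \<in> Wd n" "j \<le> m" "z \<in> K" "x = S (\<sigma> @ [j]) z"
      by (auto simp: words_Suc_iff)
    then have "x \<in> (\<Union>\<sigma>\<in>Wd n. S \<sigma> ` K)" using ifs_map_in_K by (auto simp: word_map_snoc)
    then show "x \<in> K" by (rule subsetD[OF equalityD2[OF Suc.IH]])
  qed
qed (simp add: words_0 word_map_Nil)

lemma S_in_K: "\<sigma> \<in> Wd n \<Longrightarrow> x \<in> K \<Longrightarrow> S \<sigma> x \<in> K"
  by (rule subsetD[OF equalityD2[OF K_words[of n]]], rule UN_I, assumption, rule imageI)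

lemma S_bounds:
  assumes "\<sigma> \<in> Wd n" shows "0 \<le> S \<sigma> 0" "S \<sigma> 0 + \<rho> ^ n \<le> 1"
  using subsetD[OF K_subset S_in_K[OF assms zero_in_K]] subsetD[OF K_subset S_in_K[OF assms one_in_K]]
    S_eq[OF assms, of 1] by simp_all

lemma S_image:
  assumes "\<sigma> \<in> Wd n" shows "S \<sigma> ` {0..1} = {S \<sigma> 0 .. S \<sigma> 0 + \<rho> ^ n}"
proof -
  have "S \<sigma> x = \<rho> ^ n * x + S \<sigma> 0" for x using S_eq[OF assms, of x] by linarith
  then have "S \<sigma> = (\<lambda>x. \<rho> ^ n * x + S \<sigma> 0)" by (rule ext)
  then have "S \<sigma> ` {0..1} = (\<lambda>x. \<rho> ^ n * x + S \<sigma> 0) ` {0..1}"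
    by (rule arg_cong[where f = "\<lambda>f. f ` {0..1}"])
  also have "\<dots> = {S \<sigma> 0 .. S \<sigma> 0 + \<rho> ^ n}"
    using rho by (subst image_affinity_atLeastAtMost) (auto simp: add.commute)
  finally show ?thesis .
qed

section \<open>Net points, net intervals and their nesting\<close>

lemma finite_NP: "finite (NP n)"
  by (auto simp: net_points_def)

lemma S0_in_NP: "\<sigma> \<in> Wd n \<Longrightarrow> S \<sigma> 0 \<in> NP n"
  by (auto simp: net_points_def)

lemma S_one_in_NP: "\<sigma> \<in> Wd n \<Longrightarrow> S \<sigma> 1 \<in> NP n"
  by (auto simp: net_points_def)

lemma S1_in_NP: "\<sigma> \<in> Wd n \<Longrightarrow> S \<sigma> 0 + \<rho> ^ n \<in> NP n"
  using S_one_in_NP[of \<sigma> n] S_eq[of \<sigma> n 1] by simp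

text \<open>A letter appended on the right acts first, so the new points are images under level
  \<open>n\<close> maps of a finite set of numbers that is the same for all levels.\<close>

lemma NP_Suc_iff:
  "x \<in> NP (Suc n) \<longleftrightarrow> (\<exists>\<sigma> j e. \<sigma> \<in> Wd n \<and> j \<le> m \<and> e \<in> {0, 1} \<and> x = S \<sigma> (\<rho> * e + d j))"
proof
  assume "x \<in> NP (Suc n)"
  then obtain \<tau> e where \<tau>: "\<tau> \<in> Wd (Suc n)" "e \<in> {0, 1}" "x = S \<tau> e"
    by (auto simp: net_points_def)
  then obtain \<sigma> j where \<sigma>: "\<tau> = \<sigma> @ [j]" "\<sigma> \<in> Wd n" "j \<le> m" unfolding words_Suc_iff by blast
  then have "x = S \<sigma> (\<rho> * e + d j)" using \<tau>(3) by (simp add: word_map_snoc)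
  with \<sigma> \<tau>(2) show "\<exists>\<sigma> j e. \<sigma> \<in> Wd n \<and> j \<le> m \<and> e \<in> {0, 1} \<and> x = S \<sigma> (\<rho> * e + d j)"
    by blast
next
  assume "\<exists>\<sigma> j e. \<sigma> \<in> Wd n \<and> j \<le> m \<and> e \<in> {0, 1} \<and> x = S \<sigma> (\<rho> * e + d j)"
  then obtain \<sigma> j e where "\<sigma> \<in> Wd n" "j \<le> m" "e \<in> {0, 1}" "x = S (\<sigma> @ [j]) e"
    unfolding word_map_snoc[symmetric] by blast
  moreover from this have "\<sigma> @ [j] \<in> Wd (Suc n)" by (simp add: words_Suc_iff)
  ultimately show "x \<in> NP (Suc n)"
    using S0_in_NP[of "\<sigma> @ [j]" "Suc n"] S_one_in_NP[of "\<sigma> @ [j]" "Suc n"] by auto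
qed

lemma NP_mono_Suc: "NP n \<subseteq> NP (Suc n)"
proof
  fix x assume "x \<in> NP n"
  then obtain \<sigma> where \<sigma>: "\<sigma> \<in> Wd n" "x = S \<sigma> 0 \<or> x = S \<sigma> 1" by (auto simp: net_points_def)
  obtain j where j: "j \<le> m" "\<rho> + d j = 1" using exists_top_digit by blast
  have "S (\<sigma> @ [0]) 0 = S \<sigma> 0" "S (\<sigma> @ [j]) 1 = S \<sigma> 1"
    using j d0 by (simp_all add: word_map_snoc)
  moreover have "\<sigma> @ [0] \<in> Wd (Suc n)" "\<sigma> @ [j] \<in> Wd (Suc n)" using \<sigma> j by (auto simp: words_Suc_iff)
  ultimately have "S \<sigma> 0 \<in> NP (Suc n)" "S \<sigma> 1 \<in> NP (Suc n)"
    using S0_in_NP[of "\<sigma> @ [0]" "Suc n"] S_one_in_NP[of "\<sigma> @ [j]" "Suc n"] by simp_all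
  then show "x \<in> NP (Suc n)" using \<sigma>(2) by blast
qed

lemma NP_mono: "i \<le> j \<Longrightarrow> NP i \<subseteq> NP j"
  using NP_mono_Suc by (rule lift_Suc_mono_le)

lemma NP_0: "NP 0 = {0, 1}"
  by (auto simp: net_points_def words_0 word_map_Nil)

text \<open>The general description is correct at level 0 too: the only net points there are 0 and
  1, and \<rho> is a point of \<open>K\<close> between them. This spares later case distinctions on
  the level.\<close>

lemma mem_NI_iff:
  "(a, b) \<in> NI n \<longleftrightarrow> a \<in> NP n \<and> b \<in> NP n \<and> a < b \<and> {a<..<b} \<inter> NP n = {} \<and> {a<..<b} \<inter> K \<noteq> {}"
proof (cases "n = 0")
  case True
  have "\<rho> * 1 + d 0 \<in> {0<..<1} \<inter> K" using ifs_map_in_K[of 0 1] one_in_K rho d0 by auto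
  then have "{0<..<1} \<inter> K \<noteq> {}" by blast
  then show ?thesis unfolding True NP_0 by (auto simp: net_intervals_def)
qed (simp add: net_intervals_def)

lemma NI_nonempty: "\<Delta> \<in> NI n \<Longrightarrow> fst \<Delta> < snd \<Delta>"
  by (cases \<Delta>) (simp add: mem_NI_iff)

lemma finite_NI: "finite (NI n)"
proof (rule finite_subset)
  show "NI n \<subseteq> NP n \<times> NP n" by (auto simp: mem_NI_iff)
qed (simp add: finite_NP)

lemma finite_CH: "finite (CH n \<Delta>)"
  by (rule finite_subset[OF _ finite_NI[of "Suc n"]]) (auto simp: net_children_def)

text \<open>An endpoint of the coarse interval is still a net point at the finer level, hence not
  inside the finer interval. A common interior point then forces containment.\<close>

lemma NI_subset_if_meets:
  assumes "i \<le> j" "(a, b) \<in> NI i" "(a', b') \<in> NI j" "a < y" "y < b" "a' < y" "y < b'"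
  shows "a \<le> a'" "b' \<le> b"
proof -
  have "a \<in> NP j" "b \<in> NP j" using assms NP_mono[OF assms(1)] by (auto simp: mem_NI_iff)
  then have "a \<notin> {a'<..<b'}" "b \<notin> {a'<..<b'}" using assms(3) unfolding mem_NI_iff by blast+
  then show "a \<le> a'" "b' \<le> b" using assms(4-7) by auto
qed

lemma NI_disjoint:
  assumes "(a, b) \<in> NI i" "(a', b') \<in> NI i" "a < y" "y < b" "a' < y" "y < b'"
  shows "(a, b) = (a', b')"
proof -
  have "a \<le> a'" "b' \<le> b" by (rule NI_subset_if_meets[OF order_refl assms])+
  moreover have "a' \<le> a" "b \<le> b'" by (rule NI_subset_if_meets[OF order_refl assms(2,1,5,6,3,4)])+
  ultimately show ?thesis by simp
qed

lemma exists_NI: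
  assumes "y \<in> K" "y \<notin> NP n" shows "\<exists>a b. (a, b) \<in> NI n \<and> a < y \<and> y < b"
proof -
  define a where "a = Max (NP n \<inter> {..y})"
  define b where "b = Min (NP n \<inter> {y..})"
  have "0 \<in> NP n" "1 \<in> NP n" using NP_mono[of 0 n] NP_0 by auto
  moreover have "0 \<le> y" "y \<le> 1" using assms(1) K_subset by auto
  ultimately have ne: "NP n \<inter> {..y} \<noteq> {}" "NP n \<inter> {y..} \<noteq> {}" by auto
  have fin: "finite (NP n \<inter> {..y})" "finite (NP n \<inter> {y..})" using finite_NP by auto
  have a: "a \<in> NP n \<inter> {..y}" unfolding a_def by (rule Max_in[OF fin(1) ne(1)])
  have b: "b \<in> NP n \<inter> {y..}" unfolding b_def by (rule Min_in[OF fin(2) ne(2)])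
  have ay: "a < y" "y < b" using a b assms(2) by (auto simp: less_le)
  have "z \<notin> {a<..<b}" if "z \<in> NP n" for z
  proof (cases "z \<le> y")
    case True
    then have "z \<le> a" unfolding a_def using that fin by (intro Max_ge) auto
    then show ?thesis by simp
  next
    case False
    then have "b \<le> z" unfolding b_def using that fin by (intro Min_le) auto
    then show ?thesis by simp
  qed
  then have "{a<..<b} \<inter> NP n = {}" by blast
  then show ?thesis using a b ay assms(1) by (intro exI[of _ a] exI[of _ b]) (auto simp: mem_NI_iff)
qed

text \<open>The point \<open>y\<close> chosen in the interior of \<open>\<Delta>'\<close> and in \<open>K\<close> avoids all coarser net points.\<close>

lemma exists_parent:
  assumes "i \<le> j" "(a', b') \<in> NI j"
  shows "\<exists>a b y. (a, b) \<in> NI i \<and> a \<le> a' \<and> b' \<le> b \<and> y \<in> K \<and> a' < y \<and> y < b'"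
proof -
  obtain y where y: "y \<in> K" "a' < y" "y < b'" "y \<notin> NP j" using assms(2) by (fastforce simp: mem_NI_iff)
  then obtain a b where ab: "(a, b) \<in> NI i" "a < y" "y < b"
    using exists_NI[of y i] NP_mono[OF assms(1)] by blast
  with NI_subset_if_meets[OF assms(1) ab(1) assms(2) ab(2,3) y(2,3)] y show ?thesis by blast
qed

section \<open>Neighbours and the rescaled picture of the children\<close>

definition covers :: "nat \<Rightarrow> nat list \<Rightarrow> ivl \<Rightarrow> bool" where
  "covers n \<sigma> \<Delta> \<longleftrightarrow> \<sigma> \<in> Wd n \<and> S \<sigma> 0 \<le> fst \<Delta> \<and> snd \<Delta> \<le> S \<sigma> 0 + \<rho> ^ n"

lemma set_neighbour_set:
  assumes "\<Delta> \<in> NI n"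
  shows "set (neighbour_set m \<rho> d n \<Delta>) = {(fst \<Delta> - S \<sigma> 0) / \<rho> ^ n | \<sigma>. covers n \<sigma> \<Delta>}"
    and "neighbour_set m \<rho> d n \<Delta> = sorted_list_of_set {(fst \<Delta> - S \<sigma> 0) / \<rho> ^ n | \<sigma>. covers n \<sigma> \<Delta>}"
proof -
  have "\<sigma> \<in> Wd n \<and> ivl_set \<Delta> \<subseteq> S \<sigma> ` {0..1} \<longleftrightarrow> covers n \<sigma> \<Delta>" for \<sigma>
    using NI_nonempty[OF assms] unfolding covers_def by (auto simp: S_image)
  then show *: "neighbour_set m \<rho> d n \<Delta> = sorted_list_of_set {(fst \<Delta> - S \<sigma> 0) / \<rho> ^ n | \<sigma>. covers n \<sigma> \<Delta>}"
    unfolding neighbour_set_def by presburger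
  have "{(fst \<Delta> - S \<sigma> 0) / \<rho> ^ n | \<sigma>. covers n \<sigma> \<Delta>} \<subseteq> (\<lambda>\<sigma>. (fst \<Delta> - S \<sigma> 0) / \<rho> ^ n) ` Wd n"
    by (auto simp: covers_def)
  then show "set (neighbour_set m \<rho> d n \<Delta>) = {(fst \<Delta> - S \<sigma> 0) / \<rho> ^ n | \<sigma>. covers n \<sigma> \<Delta>}"
    unfolding * by (intro set_sorted_list_of_set) (rule finite_subset, auto)
qed

text \<open>The endpoints of a copy are net points of the same level, so neither lies inside the net
  interval: a copy reaching its interior contains all of it.\<close>

lemma covers_if_meets:
  assumes "(a, b) \<in> NI n" "\<sigma> \<in> Wd n" "a < x" "x < b" "S \<sigma> 0 \<le> x" "x \<le> S \<sigma> 0 + \<rho> ^ n"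
  shows "covers n \<sigma> (a, b)"
proof -
  have "S \<sigma> 0 \<notin> {a<..<b}" "S \<sigma> 0 + \<rho> ^ n \<notin> {a<..<b}"
    using assms(1) S0_in_NP[OF assms(2)] S1_in_NP[OF assms(2)] unfolding mem_NI_iff by blast+
  then show ?thesis using assms by (auto simp: covers_def)
qed

text \<open>The children of a net interval, rescaled by \<open>x \<mapsto> (x - a) / \<rho> ^ n\<close>, can be read off its
  reduced characteristic vector.\<close>

definition child_points :: "red_vec \<Rightarrow> real set" where
  "child_points \<gamma> = {0, fst \<gamma>} \<union>
     ({\<rho> * e + d j - v | e j v. e \<in> {0, 1} \<and> j \<le> m \<and> v \<in> set (snd \<gamma>)} \<inter> {0<..<fst \<gamma>})"

text \<open>The set of differences \<open>k - v\<close> stands for the rescaled \<open>K\<close>: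
  inside the net interval, \<open>K\<close> is the union of its translates by -v over the neighbours
  v.\<close>

definition child_ivls :: "red_vec \<Rightarrow> ivl set" where
  "child_ivls \<gamma> = {(p, q). p \<in> child_points \<gamma> \<and> q \<in> child_points \<gamma> \<and> p < q \<and>
     {p<..<q} \<inter> child_points \<gamma> = {} \<and> {p<..<q} \<inter> {k - v | k v. k \<in> K \<and> v \<in> set (snd \<gamma>)} \<noteq> {}}"

text \<open>In rescaled coordinates, neighbour \<open>v\<close> followed by digit \<open>j\<close>
  gives the copy [d j - v, d j - v + \<rho>]. It contributes if it contains the child, and its
  neighbour value is the distance between the two left ends in units of \<rho>.\<close>

definition child_type :: "red_vec \<Rightarrow> ivl \<Rightarrow> red_vec" where
  "child_type \<gamma> c = ((snd c - fst c) / \<rho>, sorted_list_of_set {(fst c - d j + v) / \<rho> | v j.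
     v \<in> set (snd \<gamma>) \<and> j \<le> m \<and> d j - v \<le> fst c \<and> snd c \<le> d j - v + \<rho>})"

definition place :: "nat \<Rightarrow> ivl \<Rightarrow> ivl \<Rightarrow> ivl" where
  "place n \<Delta> c = (fst \<Delta> + \<rho> ^ n * fst c, fst \<Delta> + \<rho> ^ n * snd c)"

lemma set_snd_red: "\<Delta> \<in> NI n \<Longrightarrow> set (snd (red n \<Delta>)) = {(fst \<Delta> - S \<sigma> 0) / \<rho> ^ n | \<sigma>. covers n \<sigma> \<Delta>}"
  by (simp add: red_vector_def set_neighbour_set(1))

text \<open>After rescaling, the map of the word is the translation by -v. The word and the level
  enter in no other way, which is why a type determines its children.\<close>

lemma neighbour_eq:
  assumes "v = (a - S \<sigma> 0) / \<rho> ^ n" "\<sigma> \<in> Wd n"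
  shows "S \<sigma> x = a + \<rho> ^ n * (x - v)"
  using assms rho S_eq[OF assms(2), of x] by (simp add: field_simps)

lemma place_points:
  assumes \<Delta>: "(a, b) \<in> NI n" and x: "a \<le> x" "x \<le> b"
  shows "x \<in> NP (Suc n) \<longleftrightarrow> (x - a) / \<rho> ^ n \<in> child_points (red n (a, b))"
proof -
  let ?c = "\<rho> ^ n" and ?V = "set (snd (red n (a, b)))"
  have c: "0 < ?c" using rho by simp
  then have sc: "(x - a) / ?c = t \<longleftrightarrow> x = a + ?c * t" for t by (intro diff_divide_eq_iff) simp
  have ends: "a \<in> NP (Suc n)" "b \<in> NP (Suc n)" using \<Delta> NP_mono_Suc by (auto simp: mem_NI_iff)
  have l: "fst (red n (a, b)) = (b - a) / ?c" by (simp add: red_vector_def norm_length_def)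
  consider "x = a" | "x = b" | "a < x" "x < b" using x by linarith
  then show ?thesis
  proof cases
    case 3
    have "x \<in> NP (Suc n) \<longleftrightarrow> (\<exists>\<sigma> j e. \<sigma> \<in> Wd n \<and> j \<le> m \<and> e \<in> {0, 1} \<and> x = S \<sigma> (\<rho> * e + d j))"
      by (rule NP_Suc_iff)
    also have "\<dots> \<longleftrightarrow> (\<exists>v j e. v \<in> ?V \<and> j \<le> m \<and> e \<in> {0, 1} \<and> (x - a) / ?c = \<rho> * e + d j - v)"
    proof
      assume "\<exists>\<sigma> j e. \<sigma> \<in> Wd n \<and> j \<le> m \<and> e \<in> {0, 1} \<and> x = S \<sigma> (\<rho> * e + d j)"
      then obtain \<sigma> j e where h: "\<sigma> \<in> Wd n" "j \<le> m" "e \<in> {0, 1}" "x = S \<sigma> (\<rho> * e + d j)" by blast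
      \<comment> \<open>The new point lies in the copy of \<sigma> and inside the net interval, so
        this copy covers the interval and \<sigma> contributes a neighbour.\<close>
      have "0 \<le> \<rho> * e + d j" "\<rho> * e + d j \<le> 1" using digit_interval[of j e] h by auto
      then have "0 \<le> ?c * (\<rho> * e + d j)" "?c * (\<rho> * e + d j) \<le> ?c"
        using c by (auto intro: mult_left_le)
      then have "covers n \<sigma> (a, b)"
        using h S_eq[OF h(1), of "\<rho> * e + d j"] by (intro covers_if_meets[OF \<Delta> h(1) 3]) auto
      then have "(a - S \<sigma> 0) / ?c \<in> ?V" using set_snd_red[OF \<Delta>] by auto
      moreover have "(x - a) / ?c = \<rho> * e + d j - (a - S \<sigma> 0) / ?c"
        unfolding sc using h(4) neighbour_eq[OF refl h(1), of "\<rho> * e + d j" a] by simp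
      ultimately show "\<exists>v j e. v \<in> ?V \<and> j \<le> m \<and> e \<in> {0, 1} \<and> (x - a) / ?c = \<rho> * e + d j - v"
        using h by blast
    next
      assume "\<exists>v j e. v \<in> ?V \<and> j \<le> m \<and> e \<in> {0, 1} \<and> (x - a) / ?c = \<rho> * e + d j - v"
      then obtain v j e where h: "v \<in> ?V" "j \<le> m" "e \<in> {0, 1}" "(x - a) / ?c = \<rho> * e + d j - v" by blast
      then obtain \<sigma> where \<sigma>: "v = (a - S \<sigma> 0) / ?c" "covers n \<sigma> (a, b)" using set_snd_red[OF \<Delta>] by auto
      then have "\<sigma> \<in> Wd n" by (simp add: covers_def)
      moreover have "x = S \<sigma> (\<rho> * e + d j)"
        using h(4) unfolding sc neighbour_eq[OF \<sigma>(1) \<open>\<sigma> \<in> Wd n\<close>] .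
      ultimately show "\<exists>\<sigma> j e. \<sigma> \<in> Wd n \<and> j \<le> m \<and> e \<in> {0, 1} \<and> x = S \<sigma> (\<rho> * e + d j)"
        using h by blast
    qed
    also have "\<dots> \<longleftrightarrow> (x - a) / ?c \<in> child_points (red n (a, b))"
    proof -
      define t where "t = (x - a) / ?c"
      have "0 < t" "t < (b - a) / ?c"
        using 3 c unfolding t_def by (simp_all add: divide_strict_right_mono)
      then have t: "t \<in> {0<..<(b - a) / ?c}" "t \<noteq> 0" "t \<noteq> (b - a) / ?c" by auto
      show ?thesis unfolding t_def[symmetric] child_points_def l using t by blast
    qed
    finally show ?thesis .
  qed (use ends c in \<open>auto simp: child_points_def l\<close>)
qed

lemma place_K:
  assumes \<Delta>: "(a, b) \<in> NI n" and x: "a < x" "x < b"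
  shows "x \<in> K \<longleftrightarrow> (x - a) / \<rho> ^ n \<in> {k - v | k v. k \<in> K \<and> v \<in> set (snd (red n (a, b)))}"
proof
  let ?c = "\<rho> ^ n" and ?V = "set (snd (red n (a, b)))"
  have c: "0 < ?c" using rho by simp
  then have sc: "(x - a) / ?c = t \<longleftrightarrow> x = a + ?c * t" for t by (intro diff_divide_eq_iff) simp
  {
    assume "x \<in> K"
    then have "x \<in> (\<Union>\<sigma>\<in>Wd n. S \<sigma> ` K)" by (rule subsetD[OF equalityD1[OF K_words]])
    then obtain \<sigma> k where h: "\<sigma> \<in> Wd n" "k \<in> K" "x = S \<sigma> k" by blast
    then have "0 \<le> ?c * k" "?c * k \<le> ?c" using c K_subset by (auto intro: mult_left_le)
    then have "covers n \<sigma> (a, b)"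
      using h S_eq[OF h(1), of k] by (intro covers_if_meets[OF \<Delta> h(1) x]) auto
    then have "(a - S \<sigma> 0) / ?c \<in> ?V" using set_snd_red[OF \<Delta>] by auto
    moreover have "(x - a) / ?c = k - (a - S \<sigma> 0) / ?c"
      unfolding sc using h(3) neighbour_eq[OF refl h(1), of k a] by simp
    ultimately show "(x - a) / ?c \<in> {k - v | k v. k \<in> K \<and> v \<in> ?V}" using h by blast
  next
    assume "(x - a) / ?c \<in> {k - v | k v. k \<in> K \<and> v \<in> ?V}"
    then obtain k v where h: "k \<in> K" "v \<in> ?V" "(x - a) / ?c = k - v" by blast
    then obtain \<sigma> where \<sigma>: "v = (a - S \<sigma> 0) / ?c" "covers n \<sigma> (a, b)" using set_snd_red[OF \<Delta>] by auto
    then have "\<sigma> \<in> Wd n" by (simp add: covers_def)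
    moreover have "x = S \<sigma> k"
      using h(3) unfolding sc neighbour_eq[OF \<sigma>(1) \<open>\<sigma> \<in> Wd n\<close>] .
    ultimately show "x \<in> K" using S_in_K h(1) by blast
  }
qed

lemma place_in_CH_iff:
  assumes \<Delta>: "(a, b) \<in> NI n"
  shows "place n (a, b) c \<in> CH n (a, b) \<longleftrightarrow> c \<in> child_ivls (red n (a, b))"
proof -
  obtain p q where c: "c = (p, q)" by fastforce
  let ?r = "\<rho> ^ n"
  let ?f = "\<lambda>t. a + ?r * t"
  have r: "0 < ?r" using rho by simp
  have l: "fst (red n (a, b)) = (b - a) / ?r" by (simp add: red_vector_def norm_length_def)
  have ab: "a < b" using NI_nonempty[OF \<Delta>] by simp
  have cp: "child_points (red n (a, b)) \<subseteq> {0..(b - a) / ?r}"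
    using ab r by (auto simp: child_points_def l)
  have inner: "?f p < x \<and> x < ?f q \<longleftrightarrow> p < (x - a) / ?r \<and> (x - a) / ?r < q" for x
    using r by (auto simp: field_simps)
  have pts: "t \<in> child_points (red n (a, b)) \<longleftrightarrow> ?f t \<in> NP (Suc n)" if "0 \<le> t" "t \<le> (b - a) / ?r" for t
    using place_points[OF \<Delta>, of "?f t"] that r by (simp add: field_simps)
  have Kpts: "t \<in> {k - v | k v. k \<in> K \<and> v \<in> set (snd (red n (a, b)))} \<longleftrightarrow> ?f t \<in> K"
    if "0 < t" "t < (b - a) / ?r" for t
    using place_K[OF \<Delta>, of "?f t"] that r by (simp add: field_simps)
  have rng: "a \<le> ?f t \<longleftrightarrow> 0 \<le> t" "?f t \<le> b \<longleftrightarrow> t \<le> (b - a) / ?r" for t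
    using r by (auto simp: field_simps zero_le_mult_iff)
  have surj: "x = ?f ((x - a) / ?r)" for x using r by simp
  have ivl: "{?f p<..<?f q} = ?f ` {p<..<q}"
  proof (rule Set.set_eqI, rule iffI)
    fix x assume "x \<in> {?f p<..<?f q}"
    then have "(x - a) / ?r \<in> {p<..<q}" using inner by auto
    then show "x \<in> ?f ` {p<..<q}" using surj by blast
  qed (use r in auto)
  show ?thesis
  \<comment> \<open>The equivalences for points hold only between 0 and the normalized length; for
    other pairs both sides of the claim are false.\<close>
  proof (cases "0 \<le> p \<and> p < q \<and> q \<le> (b - a) / ?r")
    case True
    then have in_range: "0 < t \<and> t < (b - a) / ?r" if "t \<in> {p<..<q}" for t
      using that unfolding greaterThanLessThan_iff by linarith
    have "?f t \<in> NP (Suc n) \<longleftrightarrow> t \<in> child_points (red n (a, b))" if "t \<in> {p<..<q}" for t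
      using pts[of t] in_range[OF that] by auto
    then have "{?f p<..<?f q} \<inter> NP (Suc n) = {} \<longleftrightarrow> {p<..<q} \<inter> child_points (red n (a, b)) = {}"
      unfolding ivl by blast
    moreover have "?f t \<in> K \<longleftrightarrow> t \<in> {k - v | k v. k \<in> K \<and> v \<in> set (snd (red n (a, b)))}"
      if "t \<in> {p<..<q}" for t
      using Kpts[of t] in_range[OF that] by blast
    then have "{?f p<..<?f q} \<inter> K = {} \<longleftrightarrow>
        {p<..<q} \<inter> {k - v | k v. k \<in> K \<and> v \<in> set (snd (red n (a, b)))} = {}"
      unfolding ivl by blast
    moreover have "?f p < ?f q" using True r by simp
    moreover have "p \<in> child_points (red n (a, b)) \<longleftrightarrow> ?f p \<in> NP (Suc n)"
      "q \<in> child_points (red n (a, b)) \<longleftrightarrow> ?f q \<in> NP (Suc n)"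
      using pts[of p] pts[of q] True by auto
    ultimately have "(?f p, ?f q) \<in> NI (Suc n) \<longleftrightarrow> c \<in> child_ivls (red n (a, b))"
      using True unfolding mem_NI_iff c child_ivls_def by (simp only: prod.case mem_Collect_eq)
    moreover have "{?f p..?f q} \<subseteq> {a..b}" using rng(1)[of p] rng(2)[of q] True by auto
    ultimately show ?thesis by (simp add: c place_def net_children_def)
  next
    case False
    have "c \<notin> child_ivls (red n (a, b))" using False cp unfolding c child_ivls_def by fastforce
    moreover have "place n (a, b) c \<notin> CH n (a, b)"
    proof
      assume "place n (a, b) c \<in> CH n (a, b)"
      then have "?f p < ?f q" "a \<le> ?f p" "?f q \<le> b"
        unfolding c place_def net_children_def by (auto simp: mem_NI_iff)
      then show False using False rng r by simp
    qed
    ultimately show ?thesis by blast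
  qed
qed

lemma bij_betw_place:
  assumes \<Delta>: "(a, b) \<in> NI n"
  shows "bij_betw (place n (a, b)) (child_ivls (red n (a, b))) (CH n (a, b))"
proof (rule bij_betw_imageI)
  have r: "0 < \<rho> ^ n" using rho by simp
  then show "inj_on (place n (a, b)) (child_ivls (red n (a, b)))"
    by (auto simp: inj_on_def place_def)
  have "c' = place n (a, b) ((fst c' - a) / \<rho> ^ n, (snd c' - a) / \<rho> ^ n)" for c'
    using r by (simp add: place_def prod_eq_iff)
  then show "place n (a, b) ` child_ivls (red n (a, b)) = CH n (a, b)"
    using place_in_CH_iff[OF \<Delta>] by (intro equalityI subsetI) (blast, metis imageI)
qed

text \<open>A copy covering the child lies in the copy of the word without its last letter. That
  copy meets the interior of the parent and so covers it; hence all neighbours of the child descend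
  from neighbours of the parent.\<close>

lemma red_place:
  assumes \<Delta>: "(a, b) \<in> NI n" and c: "c \<in> child_ivls (red n (a, b))"
  shows "red (Suc n) (place n (a, b) c) = child_type (red n (a, b)) c"
proof -
  obtain p q where pq: "c = (p, q)" by fastforce
  let ?r = "\<rho> ^ n" and ?V = "set (snd (red n (a, b)))"
  have r: "0 < ?r" using rho by simp
  let ?a = "a + ?r * p" and ?b = "a + ?r * q"
  have "(?a, ?b) \<in> CH n (a, b)" using place_in_CH_iff[OF \<Delta>, of c] c by (simp add: place_def pq)
  then have \<Delta>': "(?a, ?b) \<in> NI (Suc n)" and sub: "a \<le> ?a" "?b \<le> b" "?a < ?b"
    by (auto simp: net_children_def mem_NI_iff)
  have "{(?a - S \<tau> 0) / \<rho> ^ Suc n | \<tau>. covers (Suc n) \<tau> (?a, ?b)} =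
    {(p - d j + v) / \<rho> | v j. v \<in> ?V \<and> j \<le> m \<and> d j - v \<le> p \<and> q \<le> d j - v + \<rho>}"
    (is "?L = ?R")
  proof (rule Set.set_eqI, rule iffI)
    fix x assume "x \<in> ?L"
    then obtain \<sigma> j where \<sigma>: "\<sigma> \<in> Wd n" "j \<le> m" "x = (?a - S \<sigma> (d j)) / \<rho> ^ Suc n"
      "S \<sigma> (d j) \<le> ?a" "?b \<le> S \<sigma> (d j) + \<rho> ^ Suc n"
      by (auto simp: covers_def words_Suc_iff word_map_snoc)
    obtain y where y: "?a < y" "y < ?b" using dense[OF sub(3)] by blast
    have "?r * (\<rho> + d j) \<le> ?r * 1" "0 \<le> ?r * d j"
      using digit_bounds[OF \<sigma>(2)] r by (auto intro: mult_left_mono)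
    then have "\<rho> ^ Suc n + ?r * d j \<le> ?r" "0 \<le> ?r * d j" by (auto simp: algebra_simps)
    then have "covers n \<sigma> (a, b)"
      using \<sigma> y sub S_eq[OF \<sigma>(1), of "d j"] by (intro covers_if_meets[OF \<Delta>, of _ y]) auto
    then have v: "(a - S \<sigma> 0) / ?r \<in> ?V" using set_snd_red[OF \<Delta>] by auto
    define v where "v = (a - S \<sigma> 0) / ?r"
    have Sd: "S \<sigma> (d j) = a + ?r * (d j - v)" by (rule neighbour_eq[OF v_def \<sigma>(1)])
    have "x = (?r * (p - d j + v)) / (?r * \<rho>)" unfolding \<sigma>(3) Sd by (simp add: algebra_simps)
    then have "x = (p - d j + v) / \<rho>" using r by simp
    moreover have "?r * (d j - v) \<le> ?r * p" using \<sigma>(4) unfolding Sd by simp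
    then have "d j - v \<le> p" using r by simp
    moreover have "?r * q \<le> ?r * (d j - v + \<rho>)" using \<sigma>(5) unfolding Sd by (simp add: algebra_simps)
    then have "q \<le> d j - v + \<rho>" using r by simp
    ultimately show "x \<in> ?R" using v \<sigma>(2) unfolding v_def[symmetric] by blast
  next
    fix x assume "x \<in> ?R"
    then obtain v j where h: "x = (p - d j + v) / \<rho>" "v \<in> ?V" "j \<le> m" "d j - v \<le> p" "q \<le> d j - v + \<rho>"
      by blast
    then obtain \<sigma> where \<sigma>: "v = (a - S \<sigma> 0) / ?r" "covers n \<sigma> (a, b)" using set_snd_red[OF \<Delta>] by auto
    then have W: "\<sigma> \<in> Wd n" by (simp add: covers_def)
    have Sd: "S (\<sigma> @ [j]) 0 = a + ?r * (d j - v)"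
      using neighbour_eq[OF \<sigma>(1) W, of "d j"] by (simp add: word_map_snoc)
    have "?r * (d j - v) \<le> ?r * p" using h(4) r by simp
    moreover have "?r * q \<le> ?r * (d j - v + \<rho>)" using h(5) r by simp
    ultimately have "covers (Suc n) (\<sigma> @ [j]) (?a, ?b)"
      using W h(3) by (auto simp: covers_def words_Suc_iff Sd algebra_simps)
    moreover have "x = (?r * (p - d j + v)) / (?r * \<rho>)" using h(1) r by simp
    then have "x = (?a - S (\<sigma> @ [j]) 0) / \<rho> ^ Suc n" unfolding Sd by (simp add: algebra_simps)
    ultimately show "x \<in> ?L" by blast
  qed
  moreover have "(?b - ?a) / \<rho> ^ Suc n = (q - p) / \<rho>"
  proof -
    have "(?b - ?a) / \<rho> ^ Suc n = (?r * (q - p)) / (?r * \<rho>)" by (simp add: algebra_simps)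
    then show ?thesis using r by simp
  qed
  moreover have "red (Suc n) (?a, ?b) = ((?b - ?a) / \<rho> ^ Suc n, sorted_list_of_set ?L)"
    unfolding red_vector_def norm_length_def set_neighbour_set(2)[OF \<Delta>'] fst_conv snd_conv ..
  ultimately show ?thesis
    unfolding place_def child_type_def pq fst_conv snd_conv by (simp only:)
qed

text \<open>Placing matches the children with \<open>child_ivls\<close> and their types with
  \<open>child_type\<close>, both functions of the type alone. So the definite description in
  \<open>child_count\<close> denotes.\<close>

lemma child_count_eq:
  assumes "\<Delta> \<in> NI n"
  shows "child_count m \<rho> d K (red n \<Delta>) \<gamma>' = card {\<Delta>' \<in> CH n \<Delta>. red (Suc n) \<Delta>' = \<gamma>'}"
proof -
  have *: "card {\<Delta>' \<in> CH n \<Delta>. red (Suc n) \<Delta>' = \<gamma>'} =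
      card {c \<in> child_ivls (red n \<Delta>). child_type (red n \<Delta>) c = \<gamma>'}" if "\<Delta> \<in> NI n" for n \<Delta>
  proof -
    obtain a b where ab: "\<Delta> = (a, b)" by fastforce
    have bij: "bij_betw (place n \<Delta>) (child_ivls (red n \<Delta>)) (CH n \<Delta>)"
      using bij_betw_place that ab by blast
    have inj: "inj_on (place n \<Delta>) {c \<in> child_ivls (red n \<Delta>). child_type (red n \<Delta>) c = \<gamma>'}"
      by (rule inj_on_subset[OF bij_betw_imp_inj_on[OF bij]]) blast
    have "red (Suc n) (place n \<Delta> c) = child_type (red n \<Delta>) c" if "c \<in> child_ivls (red n \<Delta>)" for c
      using red_place[of a b n c] that \<open>\<Delta> \<in> NI n\<close> unfolding ab by blast
    then have "{\<Delta>' \<in> CH n \<Delta>. red (Suc n) \<Delta>' = \<gamma>'} =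
        place n \<Delta> ` {c \<in> child_ivls (red n \<Delta>). child_type (red n \<Delta>) c = \<gamma>'}"
      unfolding bij_betw_imp_surj_on[OF bij, symmetric] by auto
    then show ?thesis by (simp only: card_image[OF inj])
  qed
  show ?thesis unfolding child_count_def
  proof (rule the_equality)
    show "\<forall>n'. \<forall>\<Delta>'\<in>NI n'. red n' \<Delta>' = red n \<Delta> \<longrightarrow>
        card {\<Delta>'' \<in> CH n' \<Delta>'. red (Suc n') \<Delta>'' = \<gamma>'} = card {\<Delta>' \<in> CH n \<Delta>. red (Suc n) \<Delta>' = \<gamma>'}"
      using * assms by simp
  qed (use assms in blast)
qed

end

section \<open>Descendants of a net interval\<close>

text \<open>Left endpoints of the intervals are \<open>L\<close>-separated, so \<open>x \<mapsto> \<lfloor>(x - A) / L\<rfloor>\<close> is injective on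
  them.\<close>

lemma card_separated_intervals_le:
  fixes T :: "(real \<times> real) set"
  assumes "finite T" "0 < L" "\<And>a b. (a, b) \<in> T \<Longrightarrow> L \<le> b - a"
    and sep: "\<And>a b a' b'. (a, b) \<in> T \<Longrightarrow> (a', b') \<in> T \<Longrightarrow> (a, b) \<noteq> (a', b') \<Longrightarrow> b \<le> a' \<or> b' \<le> a"
    and rng: "\<And>a b. (a, b) \<in> T \<Longrightarrow> A \<le> a \<and> a \<le> B" and "A \<le> B"
  shows "real (card T) \<le> (B - A) / L + 1"
proof -
  define h where "h = (\<lambda>p :: real \<times> real. \<lfloor>(fst p - A) / L\<rfloor>)"
  have less: "h (a, b) < h (a', b')" if "(a, b) \<in> T" "b \<le> a'" for a b a' b'
  proof -
    have "a + L \<le> a'" using assms(3)[OF that(1)] that(2) by linarith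
    then have "(a - A + L) / L \<le> (a' - A) / L" using \<open>0 < L\<close> by (intro divide_right_mono) auto
    then have "(a - A) / L + 1 \<le> (a' - A) / L" using \<open>0 < L\<close> by (simp add: add_divide_distrib)
    then show ?thesis unfolding h_def fst_conv by linarith
  qed
  have "inj_on h T"
  proof (rule inj_onI)
    fix p q assume pq: "p \<in> T" "q \<in> T" "h p = h q"
    obtain a b where p: "p = (a, b)" by (cases p)
    obtain a' b' where q: "q = (a', b')" by (cases q)
    show "p = q"
    proof (rule ccontr)
      assume "p \<noteq> q"
      then have "b \<le> a' \<or> b' \<le> a" using sep pq(1,2) unfolding p q by blast
      then show False using less[of a b a' b'] less[of a' b' a b] pq unfolding p q by auto
    qed
  qed
  moreover have "h ` T \<subseteq> {0..\<lfloor>(B - A) / L\<rfloor>}"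
  proof
    fix z assume "z \<in> h ` T"
    then obtain a b where ab: "(a, b) \<in> T" "z = h (a, b)" by auto
    then have "0 \<le> (a - A) / L" "(a - A) / L \<le> (B - A) / L"
      using rng[OF ab(1)] \<open>0 < L\<close> by (auto simp: divide_right_mono)
    then show "z \<in> {0..\<lfloor>(B - A) / L\<rfloor>}" unfolding ab(2) h_def fst_conv by (simp add: floor_mono)
  qed
  ultimately have "card T \<le> card {0..\<lfloor>(B - A) / L\<rfloor>}" by (metis card_inj_on_le finite_atLeastAtMost_int)
  moreover have "0 \<le> (B - A) / L" using assms by simp
  ultimately show ?thesis by simp linarith
qed

context unit_ifs begin

definition desc :: "nat \<Rightarrow> nat \<Rightarrow> ivl \<Rightarrow> ivl set" where
  "desc n k \<Delta> = {\<Delta>' \<in> NI (n + k). ivl_set \<Delta>' \<subseteq> ivl_set \<Delta>}"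

lemma CH_eq_desc: "CH n \<Delta> = desc n 1 \<Delta>"
  by (simp add: net_children_def desc_def)

lemma mem_desc_iff:
  "(a', b') \<in> desc n k (a, b) \<longleftrightarrow> (a', b') \<in> NI (n + k) \<and> a \<le> a' \<and> b' \<le> b"
  using NI_nonempty[of "(a', b')" "n + k"] by (auto simp: desc_def)

lemma finite_desc: "finite (desc n k \<Delta>)"
  by (rule finite_subset[OF _ finite_NI[of "n + k"]]) (auto simp: desc_def)

lemma desc_0:
  assumes "(a, b) \<in> NI n" shows "desc n 0 (a, b) = {(a, b)}"
proof -
  have "(a', b') = (a, b)" if "(a', b') \<in> desc n 0 (a, b)" for a' b'
  proof -
    have *: "(a', b') \<in> NI n" "a \<le> a'" "b' \<le> b" using that by (simp_all add: mem_desc_iff)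
    obtain y where "a' < y" "y < b'" using NI_nonempty[OF *(1)] dense[of a' b'] by auto
    then show ?thesis using * by (intro NI_disjoint[OF *(1) assms, of y]) auto
  qed
  then show ?thesis using assms by (auto simp: mem_desc_iff)
qed

text \<open>The intermediate ancestor is found at a point of \<open>K\<close> inside the descendant.
  This point is also interior to \<open>(a, b)\<close>, which forces the ancestor into
  \<open>(a, b)\<close>.\<close>

lemma desc_add:
  assumes "(a, b) \<in> NI n"
  shows "desc n (j + k) (a, b) = (\<Union>\<Delta>\<in>desc n j (a, b). desc (n + j) k \<Delta>)"
proof (rule Set.set_eqI, rule iffI)
  fix \<Delta>' assume \<Delta>': "\<Delta>' \<in> desc n (j + k) (a, b)"
  obtain a' b' where ab': "\<Delta>' = (a', b')" by (cases \<Delta>')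
  have *: "(a', b') \<in> NI (n + (j + k))" "a \<le> a'" "b' \<le> b" using \<Delta>' unfolding ab' mem_desc_iff by auto
  obtain u v y where uv: "(u, v) \<in> NI (n + j)" "u \<le> a'" "b' \<le> v" "a' < y" "y < b'"
    using exists_parent[OF _ *(1), of "n + j"] by auto
  have "a < y" "y < b" "u < y" "y < v" using uv(2-5) *(2,3) by linarith+
  then have "a \<le> u" "v \<le> b" using NI_subset_if_meets[OF _ assms uv(1)] by simp_all
  then show "\<Delta>' \<in> (\<Union>\<Delta>\<in>desc n j (a, b). desc (n + j) k \<Delta>)"
    using uv * by (intro UN_I[of "(u, v)"]) (auto simp: ab' mem_desc_iff add.assoc)
next
  fix \<Delta>' assume "\<Delta>' \<in> (\<Union>\<Delta>\<in>desc n j (a, b). desc (n + j) k \<Delta>)"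
  then show "\<Delta>' \<in> desc n (j + k) (a, b)" by (fastforce simp: desc_def add.assoc)
qed

lemma desc_disjoint:
  assumes "\<Delta>\<^sub>1 \<in> NI n" "\<Delta>\<^sub>2 \<in> NI n" "\<Delta>\<^sub>1 \<noteq> \<Delta>\<^sub>2"
  shows "desc n k \<Delta>\<^sub>1 \<inter> desc n k \<Delta>\<^sub>2 = {}"
proof -
  obtain a b where 1: "\<Delta>\<^sub>1 = (a, b)" by (cases \<Delta>\<^sub>1)
  obtain u v where 2: "\<Delta>\<^sub>2 = (u, v)" by (cases \<Delta>\<^sub>2)
  have False if "(a', b') \<in> desc n k \<Delta>\<^sub>1" "(a', b') \<in> desc n k \<Delta>\<^sub>2" for a' b'
  proof -
    have *: "(a', b') \<in> NI (n + k)" "a \<le> a'" "b' \<le> b" "u \<le> a'" "b' \<le> v"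
      using that unfolding 1 2 mem_desc_iff by auto
    obtain y where "a' < y" "y < b'" using NI_nonempty[OF *(1)] dense[of a' b'] by auto
    then have "(a, b) = (u, v)"
      using * assms(1,2) unfolding 1 2 by (intro NI_disjoint[of a b n u v y]) auto
    then show False using assms(3) unfolding 1 2 by simp
  qed
  then show ?thesis by auto
qed

text \<open>\<open>T\<close> may be a proper part of a generation, because the mass bound sums only
  over the intervals that meet a given set.\<close>

lemma sum_desc_add:
  assumes "\<Delta> \<in> NI n" "T \<subseteq> desc n j \<Delta>"
  shows "(\<Sum>\<Delta>'\<in>(\<Union>\<Delta>\<in>T. desc (n + j) k \<Delta>). g \<Delta>') = (\<Sum>\<Delta>\<in>T. \<Sum>\<Delta>'\<in>desc (n + j) k \<Delta>. g \<Delta>' :: real)"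
proof (rule sum.UNION_disjoint)
  show "finite T" using finite_subset[OF assms(2) finite_desc] .
  have "T \<subseteq> NI (n + j)" using assms(2) by (auto simp: desc_def)
  then show "\<forall>\<Delta>\<in>T. \<forall>\<Delta>'\<in>T. \<Delta> \<noteq> \<Delta>' \<longrightarrow> desc (n + j) k \<Delta> \<inter> desc (n + j) k \<Delta>' = {}"
    using desc_disjoint by blast
qed (simp add: finite_desc)

text \<open>A point of \<open>K\<close> inside the interval lies in a copy of level
  \<open>n\<close>, which then covers the interval and has length \<rho>^n.\<close>

lemma NI_length_le:
  assumes "(a, b) \<in> NI n" shows "b - a \<le> \<rho> ^ n"
proof -
  obtain y where y: "y \<in> K" "a < y" "y < b" using assms by (auto simp: mem_NI_iff)
  then obtain \<sigma> x where \<sigma>: "\<sigma> \<in> Wd n" "x \<in> K" "y = S \<sigma> x"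
    using subsetD[OF equalityD1[OF K_words[of n]] y(1)] by auto
  have "0 \<le> \<rho> ^ n * x" "\<rho> ^ n * x \<le> \<rho> ^ n"
    using subsetD[OF K_subset \<sigma>(2)] rho by (auto intro: mult_left_le)
  then have "covers n \<sigma> (a, b)"
    using y \<sigma>(3) S_eq[OF \<sigma>(1), of x] by (intro covers_if_meets[OF assms \<sigma>(1), of y]) auto
  then show ?thesis by (auto simp: covers_def)
qed

text \<open>Take a copy through an interior point of \<open>K\<close> that is shorter than the
  distance of this point to both endpoints. Through such a copy, covers of a net interval yield
  covers of \<open>K\<close>.\<close>

lemma exists_cylinder:
  assumes "(a, b) \<in> NI n"
  shows "\<exists>N \<sigma>. \<sigma> \<in> Wd N \<and> a < S \<sigma> 0 \<and> S \<sigma> 0 + \<rho> ^ N < b"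
proof -
  obtain y where y: "y \<in> K" "a < y" "y < b" using assms by (auto simp: mem_NI_iff)
  obtain N where N: "\<rho> ^ N < min (y - a) (b - y)"
    using real_arch_pow_inv[of "min (y - a) (b - y)" \<rho>] rho y by auto
  obtain \<sigma> x where \<sigma>: "\<sigma> \<in> Wd N" "x \<in> K" "y = S \<sigma> x"
    using subsetD[OF equalityD1[OF K_words[of N]] y(1)] by auto
  have "0 \<le> \<rho> ^ N * x" "\<rho> ^ N * x \<le> \<rho> ^ N"
    using subsetD[OF K_subset \<sigma>(2)] rho by (auto intro: mult_left_le)
  then show ?thesis using N \<sigma>(1,3) S_eq[OF \<sigma>(1), of x] by (intro exI[of _ N] exI[of _ \<sigma>]) auto
qed

lemma infinite_K: "infinite K"
proof -
  have "\<rho> ^ k \<in> K" for k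
  proof (induction k)
    case (Suc k)
    then show ?case using ifs_map_in_K[of 0 "\<rho> ^ k"] d0 by simp
  qed (simp add: one_in_K)
  then have "range (\<lambda>k. \<rho> ^ k) \<subseteq> K" by blast
  moreover have "inj (\<lambda>k. \<rho> ^ k)"
  proof (rule injI)
    fix i j assume "\<rho> ^ i = \<rho> ^ j"
    then show "i = j"
      using power_strict_decreasing_iff[OF rho, of i j] power_strict_decreasing_iff[OF rho, of j i] by simp
  qed
  ultimately show ?thesis using range_inj_infinite infinite_super by blast
qed

lemma interior_K_subset_desc:
  assumes "(a, b) \<in> NI n" "z \<in> K" "a < z" "z < b" "z \<notin> NP (n + k)"
  shows "\<exists>a' b'. (a', b') \<in> desc n k (a, b) \<and> a' < z \<and> z < b'"
proof -
  obtain a' b' where *: "(a', b') \<in> NI (n + k)" "a' < z" "z < b'" using exists_NI assms(2,5) by blast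
  then show ?thesis
    using NI_subset_if_meets[OF _ assms(1) *(1) assms(3,4) *(2,3)] by (auto simp: mem_desc_iff)
qed

lemma cylinder_in_K:
  assumes "\<sigma> \<in> Wd N" "x \<in> K"
  shows "S \<sigma> x \<in> K" "S \<sigma> 0 \<le> S \<sigma> x" "S \<sigma> x \<le> S \<sigma> 0 + \<rho> ^ N"
proof -
  have "0 \<le> \<rho> ^ N * x" "\<rho> ^ N * x \<le> \<rho> ^ N"
    using subsetD[OF K_subset assms(2)] rho by (auto intro: mult_left_le)
  then show "S \<sigma> x \<in> K" "S \<sigma> 0 \<le> S \<sigma> x" "S \<sigma> x \<le> S \<sigma> 0 + \<rho> ^ N"
    using S_in_K[OF assms] S_eq[OF assms(1), of x] by auto
qed

text \<open>The interior contains a copy of the infinite set \<open>K\<close>, of which only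
  finitely many points are net points of level \<open>n + k\<close>; any other point lies inside a
  descendant.\<close>

lemma desc_nonempty:
  assumes "(a, b) \<in> NI n" shows "desc n k (a, b) \<noteq> {}"
proof -
  obtain N \<sigma> where \<sigma>: "\<sigma> \<in> Wd N" "a < S \<sigma> 0" "S \<sigma> 0 + \<rho> ^ N < b" using exists_cylinder[OF assms] by blast
  have "inj_on (S \<sigma>) K"
  proof (rule inj_onI)
    fix x y assume "S \<sigma> x = S \<sigma> y"
    then show "x = y" using S_eq[OF \<sigma>(1), of x] S_eq[OF \<sigma>(1), of y] by simp
  qed
  then have "infinite (S \<sigma> ` K)" using infinite_K finite_imageD by blast
  then obtain z where z: "z \<in> S \<sigma> ` K" "z \<notin> NP (n + k)"
    using finite_subset[OF _ finite_NP[of "n + k"]] by blast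
  then obtain x where x: "x \<in> K" "z = S \<sigma> x" by blast
  have "z \<in> K" "a < z" "z < b" using cylinder_in_K[OF \<sigma>(1) x(1)] \<sigma>(2,3) unfolding x(2) by linarith+
  then show ?thesis using interior_K_subset_desc[OF assms _ _ _ z(2)] by blast
qed

end

section \<open>The dimension from a positive eigenvector\<close>

text \<open>In the application \<open>G\<close> is the set of types of the essential class and \<open>f\<close> is the positive
  eigenvector of its incidence matrix.\<close>

locale weighted_net = unit_ifs +
  fixes G :: "red_vec set" and f :: "red_vec \<Rightarrow> real" and lam :: real
    and n\<^sub>0 :: nat and a\<^sub>0 b\<^sub>0 :: real
  assumes finite_G: "finite G"
    and length_pos: "\<gamma> \<in> G \<Longrightarrow> 0 < fst \<gamma>"
    and closed: "\<Delta> \<in> NI n \<Longrightarrow> red n \<Delta> \<in> G \<Longrightarrow> \<Delta>' \<in> CH n \<Delta> \<Longrightarrow> red (Suc n) \<Delta>' \<in> G"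
    and f_pos: "\<gamma> \<in> G \<Longrightarrow> 0 < f \<gamma>"
    and eigen: "\<Delta> \<in> NI n \<Longrightarrow> red n \<Delta> \<in> G \<Longrightarrow> (\<Sum>\<Delta>'\<in>CH n \<Delta>. f (red (Suc n) \<Delta>')) = lam * f (red n \<Delta>)"
    and base: "(a\<^sub>0, b\<^sub>0) \<in> NI n\<^sub>0" and base_G: "red n\<^sub>0 (a\<^sub>0, b\<^sub>0) \<in> G"
begin

section \<open>Weights of the descendants and their conservation\<close>

abbreviation "D k \<equiv> desc n\<^sub>0 k (a\<^sub>0, b\<^sub>0)"

definition "f_min = Min (f ` G)"
definition "f_max = Max (f ` G)"
definition "l_min = Min (fst ` G)"

lemma G_ne: "G \<noteq> {}" using base_G by blast

lemma f_min: "0 < f_min" "\<gamma> \<in> G \<Longrightarrow> f_min \<le> f \<gamma>"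
  unfolding f_min_def using finite_G G_ne f_pos by (auto simp: Min_gr_iff)

lemma f_max: "\<gamma> \<in> G \<Longrightarrow> f \<gamma> \<le> f_max"
  unfolding f_max_def using finite_G by auto

lemma f_max_pos: "0 < f_max"
  using f_max[OF base_G] f_pos[OF base_G] by linarith

lemma l_min: "0 < l_min" "\<gamma> \<in> G \<Longrightarrow> l_min \<le> fst \<gamma>"
  unfolding l_min_def using finite_G G_ne length_pos by (auto simp: Min_gr_iff)

lemma desc_G: "\<Delta> \<in> NI n \<Longrightarrow> red n \<Delta> \<in> G \<Longrightarrow> \<Delta>' \<in> desc n k \<Delta> \<Longrightarrow> red (n + k) \<Delta>' \<in> G"
proof (induction k arbitrary: \<Delta>')
  case 0
  obtain a b where "\<Delta> = (a, b)" by (cases \<Delta>)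
  then show ?case using 0 desc_0[of a b n] by simp
next
  case (Suc k)
  obtain a b where ab: "\<Delta> = (a, b)" by (cases \<Delta>)
  obtain \<Delta>'' where *: "\<Delta>'' \<in> desc n k \<Delta>" "\<Delta>' \<in> CH (n + k) \<Delta>''"
    using Suc.prems desc_add[of a b n k 1] unfolding ab CH_eq_desc by auto
  then have "\<Delta>'' \<in> NI (n + k)" by (simp add: desc_def)
  then show ?case using closed[OF _ Suc.IH[OF Suc.prems(1,2) *(1)] *(2)] by simp
qed

lemma sum_desc: "\<Delta> \<in> NI n \<Longrightarrow> red n \<Delta> \<in> G \<Longrightarrow> (\<Sum>\<Delta>'\<in>desc n k \<Delta>. f (red (n + k) \<Delta>')) = lam ^ k * f (red n \<Delta>)"
proof (induction k)
  case 0
  obtain a b where "\<Delta> = (a, b)" by (cases \<Delta>)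
  then show ?case using 0 desc_0[of a b n] by simp
next
  case (Suc k)
  obtain a b where ab: "\<Delta> = (a, b)" by (cases \<Delta>)
  have eq: "desc n (Suc k) \<Delta> = (\<Union>\<Delta>\<in>desc n k \<Delta>. desc (n + k) 1 \<Delta>)"
    using desc_add[of a b n k 1] Suc.prems unfolding ab by simp
  have "(\<Sum>\<Delta>'\<in>desc n (Suc k) \<Delta>. f (red (n + Suc k) \<Delta>'))
      = (\<Sum>\<Delta>''\<in>desc n k \<Delta>. \<Sum>\<Delta>'\<in>desc (n + k) 1 \<Delta>''. f (red (n + Suc k) \<Delta>'))"
    unfolding eq by (rule sum_desc_add[OF Suc.prems(1) subset_refl])
  also have "\<dots> = (\<Sum>\<Delta>''\<in>desc n k \<Delta>. lam * f (red (n + k) \<Delta>''))"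
  proof (rule sum.cong[OF refl])
    fix \<Delta>'' assume *: "\<Delta>'' \<in> desc n k \<Delta>"
    then have "\<Delta>'' \<in> NI (n + k)" by (simp add: desc_def)
    then show "(\<Sum>\<Delta>'\<in>desc (n + k) 1 \<Delta>''. f (red (n + Suc k) \<Delta>')) = lam * f (red (n + k) \<Delta>'')"
      using eigen[OF _ desc_G[OF Suc.prems *]] unfolding CH_eq_desc by simp
  qed
  also have "\<dots> = lam ^ Suc k * f (red n \<Delta>)"
    using Suc by (simp add: sum_distrib_left[symmetric])
  finally show ?case .
qed

lemma card_D_le: "real (card (D k)) * f_min \<le> lam ^ k * f (red n\<^sub>0 (a\<^sub>0, b\<^sub>0))"
proof -
  have "real (card (D k)) * f_min = (\<Sum>\<Delta>\<in>D k. f_min)" by simp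
  also have "\<dots> \<le> (\<Sum>\<Delta>\<in>D k. f (red (n\<^sub>0 + k) \<Delta>))"
    using desc_G[OF base base_G] f_min(2) by (intro sum_mono) blast
  finally show ?thesis using sum_desc[OF base base_G] by simp
qed

text \<open>No generation is empty, so the total weight of generation k, a constant times lam^k,
  never falls below \<open>f_min\<close>.\<close>

lemma lam_ge_1: "1 \<le> lam"
proof -
  let ?c = "f (red n\<^sub>0 (a\<^sub>0, b\<^sub>0))"
  have c: "0 < ?c" by (rule f_pos[OF base_G])
  have bound: "f_min \<le> lam ^ k * ?c" for k
  proof -
    have "0 < card (D k)" using desc_nonempty[OF base] finite_desc by (simp add: card_gt_0_iff)
    then have "1 * f_min \<le> real (card (D k)) * f_min" using f_min(1) by (intro mult_right_mono) auto
    then show ?thesis using card_D_le[of k] by linarith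
  qed
  have "0 < lam * ?c" using bound[of 1] f_min(1) by simp
  then have "0 < lam" using c zero_less_mult_pos2 by blast
  show ?thesis
  proof (rule ccontr)
    assume "\<not> 1 \<le> lam"
    then obtain k where "lam ^ k < f_min / ?c"
      using real_arch_pow_inv[of "f_min / ?c" lam] f_min(1) c by auto
    then have "lam ^ k * ?c < f_min" using c by (simp add: field_simps)
    then show False using bound[of k] by linarith
  qed
qed

lemma rho_powr_power: "(\<rho> ^ k) powr s = (\<rho> powr s) ^ k"
  using rho by (simp add: powr_realpow[symmetric] powr_powr powr_power mult.commute)

lemma rho_powr_dim: "\<rho> powr (ln lam / \<bar>ln \<rho>\<bar>) = 1 / lam"
proof -
  have "ln \<rho> < 0" using rho by simp
  then have "\<rho> powr (ln lam / \<bar>ln \<rho>\<bar>) = exp (- ln lam)"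
    unfolding powr_def using rho by simp
  then show ?thesis using lam_ge_1 by (simp add: exp_minus divide_inverse)
qed

section \<open>Upper bound: covering K by magnified descendants\<close>

lemma hausdorff_measure_K_eq_0:
  assumes t: "ln lam / \<bar>ln \<rho>\<bar> < t"
  shows "hausdorff_measure t K = 0"
proof -
  obtain N \<sigma> where \<sigma>: "\<sigma> \<in> Wd N" "a\<^sub>0 < S \<sigma> 0" "S \<sigma> 0 + \<rho> ^ N < b\<^sub>0" using exists_cylinder[OF base] by blast
  have r: "0 < \<rho> ^ N" using rho by simp
  have s0: "0 \<le> ln lam / \<bar>ln \<rho>\<bar>" using lam_ge_1 by simp
  with t have "0 < t" by linarith
  \<comment> \<open>About lam^k descendants of length about \<rho>^k contribute about q^k to the sum
    of t-th powers, and q < 1 because \<open>t\<close> exceeds the exponent at which \<rho>^t is 1 /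
    lam.\<close>
  define q where "q = lam * \<rho> powr t"
  have "\<rho> powr t < \<rho> powr (ln lam / \<bar>ln \<rho>\<bar>)" using t rho by (intro powr_less_mono') auto
  then have "q < lam * (1 / lam)" unfolding q_def rho_powr_dim using lam_ge_1 by (intro mult_strict_left_mono) auto
  then have q: "0 \<le> q" "q < 1" using lam_ge_1 by (auto simp: q_def)
  \<comment> \<open>\<open>g\<close> inverts S \<sigma>, so it magnifies the copy of
    \<open>K\<close> inside the base interval to \<open>K\<close> itself; \<open>R\<close> collects
    the resulting constant factors in the lengths.\<close>
  define g where "g = (\<lambda>z. (z - S \<sigma> 0) / \<rho> ^ N)"
  define R where "R = \<rho> ^ n\<^sub>0 / \<rho> ^ N"
  define C where "C = f (red n\<^sub>0 (a\<^sub>0, b\<^sub>0)) / f_min * R powr t"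
  have R: "0 < R" using rho by (simp add: R_def)
  have C: "0 \<le> C" using f_pos[OF base_G] f_min(1) by (simp add: C_def)
  show ?thesis
  proof (rule hausdorff_measure_eq_0I[OF \<open>0 < t\<close>])
    fix \<delta> \<epsilon> :: real assume "0 < \<delta>" "0 < \<epsilon>"
    have "\<forall>\<^sub>F k in sequentially. R * \<rho> ^ k < \<delta>"
      using rho \<open>0 < \<delta>\<close> by (intro order_tendstoD(2)[where y = "R * 0"] tendsto_intros LIMSEQ_power_zero) auto
    moreover have "\<forall>\<^sub>F k in sequentially. C * q ^ k < \<epsilon>"
      using q \<open>0 < \<epsilon>\<close> by (intro order_tendstoD(2)[where y = "C * 0"] tendsto_intros LIMSEQ_power_zero) auto
    ultimately have "\<forall>\<^sub>F k in sequentially. R * \<rho> ^ k < \<delta> \<and> C * q ^ k < \<epsilon>" by eventually_elim simp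
    then obtain k where k: "R * \<rho> ^ k < \<delta>" "C * q ^ k < \<epsilon>"
      using eventually_happens[of _ sequentially] by auto
    \<comment> \<open>Points of the copy that are net points of this level may escape the
      descendants. Degenerate intervals catch them at no cost, as their diameter is 0 and
      \<open>0 < t\<close>.\<close>
    define Z where "Z = (\<lambda>z. (z, z)) ` NP (n\<^sub>0 + k)"
    define U where "U = (\<lambda>p. {g (fst p)..g (snd p)})"
    have fin: "finite (D k \<union> Z)" using finite_desc finite_NP by (simp add: Z_def)
    have diam: "diameter (U (a, b)) = (b - a) / \<rho> ^ N" if "a \<le> b" for a b
    proof -
      have "g a \<le> g b" using that r by (simp add: g_def divide_right_mono)
      then have "diameter (U (a, b)) = g b - g a" unfolding U_def by simp
      then show ?thesis by (simp add: g_def diff_divide_distrib)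
    qed
    have D_len: "diameter (U p) \<le> R * \<rho> ^ k" "0 \<le> diameter (U p)" if "p \<in> D k" for p
    proof -
      obtain a b where p: "p = (a, b)" by (cases p)
      have ab: "(a, b) \<in> NI (n\<^sub>0 + k)" using that by (simp add: p mem_desc_iff)
      have "a < b" using NI_nonempty[OF ab] by simp
      have "(b - a) / \<rho> ^ N \<le> \<rho> ^ (n\<^sub>0 + k) / \<rho> ^ N"
        using NI_length_le[OF ab] r by (intro divide_right_mono) auto
      then show "diameter (U p) \<le> R * \<rho> ^ k" "0 \<le> diameter (U p)"
        using diam[of a b] \<open>a < b\<close> r unfolding p by (auto simp: R_def power_add)
    qed
    have Z_len: "diameter (U p) = 0" if "p \<in> Z" for p
      using that diam by (auto simp: Z_def)
    have "K \<subseteq> \<Union>(U ` (D k \<union> Z))"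
    proof
      fix x assume x: "x \<in> K"
      define z where "z = S \<sigma> x"
      have z: "z \<in> K" "a\<^sub>0 < z" "z < b\<^sub>0" using cylinder_in_K[OF \<sigma>(1) x] \<sigma>(2,3) unfolding z_def by auto
      have gz: "g z = x" using S_eq[OF \<sigma>(1), of x] by (simp add: g_def z_def)
      have "\<exists>p\<in>D k \<union> Z. fst p \<le> z \<and> z \<le> snd p"
      proof (cases "z \<in> NP (n\<^sub>0 + k)")
        case True
        then show ?thesis by (intro bexI[of _ "(z, z)"]) (auto simp: Z_def)
      next
        case False
        then obtain a b where "(a, b) \<in> D k" "a < z" "z < b"
          using interior_K_subset_desc[OF base z] by blast
        then show ?thesis by (intro bexI[of _ "(a, b)"]) auto
      qed
      then obtain p where p: "p \<in> D k \<union> Z" "fst p \<le> z" "z \<le> snd p" by blast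
      then have "g (fst p) \<le> g z" "g z \<le> g (snd p)" using r by (auto simp: g_def divide_right_mono)
      then have "x \<in> U p" by (simp add: gz U_def)
      then show "x \<in> \<Union>(U ` (D k \<union> Z))" using p(1) by blast
    qed
    moreover have "\<forall>V\<in>U ` (D k \<union> Z). bounded V \<and> diameter V \<le> \<delta>"
    proof
      fix V assume "V \<in> U ` (D k \<union> Z)"
      then obtain p where p: "p \<in> D k \<union> Z" "V = U p" by blast
      have "diameter (U p) \<le> \<delta>" using D_len(1)[of p] Z_len[of p] p(1) k(1) \<open>0 < \<delta>\<close> by auto
      then show "bounded V \<and> diameter V \<le> \<delta>" unfolding p(2) by (simp add: U_def)
    qed
    moreover have "(\<Sum>V\<in>U ` (D k \<union> Z). diameter V powr t) \<le> \<epsilon>"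
    proof -
      have "(\<Sum>V\<in>U ` (D k \<union> Z). diameter V powr t) \<le> (\<Sum>p\<in>D k \<union> Z. diameter (U p) powr t)"
        using sum_image_le[OF fin, of "\<lambda>V. diameter V powr t" U] by (simp add: comp_def)
      also have "\<dots> = (\<Sum>p\<in>D k. diameter (U p) powr t)"
        using fin Z_len by (intro sum.mono_neutral_right) auto
      also have "\<dots> \<le> (\<Sum>p\<in>D k. (R * \<rho> ^ k) powr t)"
        using D_len \<open>0 < t\<close> by (intro sum_mono powr_mono2) auto
      also have "\<dots> = real (card (D k)) * ((R * \<rho> ^ k) powr t)" by simp
      also have "\<dots> = real (card (D k)) * (R powr t * (\<rho> powr t) ^ k)"
        using R rho by (simp add: powr_mult rho_powr_power)
      also have "\<dots> \<le> (lam ^ k * f (red n\<^sub>0 (a\<^sub>0, b\<^sub>0)) / f_min) * (R powr t * (\<rho> powr t) ^ k)"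
        using card_D_le[of k] f_min(1) by (intro mult_right_mono) (auto simp: field_simps)
      also have "\<dots> = C * q ^ k" by (simp add: C_def q_def power_mult_distrib)
      finally show ?thesis using k(2) by linarith
    qed
    ultimately show "\<exists>F. finite F \<and> K \<subseteq> \<Union>F \<and> (\<forall>V\<in>F. bounded V \<and> diameter V \<le> \<delta>) \<and>
        (\<Sum>V\<in>F. diameter V powr t) \<le> \<epsilon>"
      using fin by (intro exI[of _ "U ` (D k \<union> Z)"]) blast
  qed
qed

section \<open>Lower bound: mass distribution over finite covers\<close>

definition "meeting k V = {\<Delta> \<in> D k. ivl_set \<Delta> \<inter> V \<noteq> {}}"

text \<open>With R the scale of generation \<open>j\<close>, the set \<open>V\<close> lies within R
  of a point v, and an interval meeting it starts at most R further left. All left endpoints thus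
  lie in [v - 2 R, v + R], of length 3 R, while the intervals have disjoint interiors and length at
  least l_min R.\<close>

lemma card_meeting_le:
  assumes V: "\<And>x y. x \<in> V \<Longrightarrow> y \<in> V \<Longrightarrow> dist x y \<le> \<rho> ^ (n\<^sub>0 + j)"
  shows "real (card (meeting j V)) \<le> 3 / l_min + 1"
proof (cases "V = {}")
  case True
  then show ?thesis using l_min(1) by (simp add: meeting_def)
next
  case False
  then obtain v where v: "v \<in> V" by blast
  let ?R = "\<rho> ^ (n\<^sub>0 + j)"
  have R: "0 < ?R" using rho by simp
  have meet: "(a, b) \<in> NI (n\<^sub>0 + j) \<and> red (n\<^sub>0 + j) (a, b) \<in> G \<and> (\<exists>w\<in>V. a \<le> w \<and> w \<le> b)"
    if "(a, b) \<in> meeting j V" for a b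
    using that desc_G[OF base base_G, of "(a, b)" j] by (auto simp: meeting_def mem_desc_iff)
  have "real (card (meeting j V)) \<le> ((v + ?R) - (v - 2 * ?R)) / (l_min * ?R) + 1"
  proof (rule card_separated_intervals_le)
    show "finite (meeting j V)" using finite_desc by (simp add: meeting_def)
    show "0 < l_min * ?R" using l_min(1) R by simp
    show "v - 2 * ?R \<le> v + ?R" using R by simp
    fix a b assume ab: "(a, b) \<in> meeting j V"
    have "l_min \<le> (b - a) / ?R"
      using l_min(2)[of "red (n\<^sub>0 + j) (a, b)"] meet[OF ab] by (simp add: red_vector_def norm_length_def)
    then show "l_min * ?R \<le> b - a" using R by (simp add: pos_le_divide_eq)
    obtain w where w: "w \<in> V" "a \<le> w" "w \<le> b" using meet[OF ab] by blast
    have "b - a \<le> ?R" using NI_length_le meet[OF ab] by blast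
    moreover have "\<bar>w - v\<bar> \<le> ?R" using V[OF w(1) v] by (simp add: dist_real_def)
    ultimately show "v - 2 * ?R \<le> a \<and> a \<le> v + ?R" using w(2,3) unfolding abs_le_iff by linarith
    fix a' b' assume ab': "(a', b') \<in> meeting j V" "(a, b) \<noteq> (a', b')"
    show "b \<le> a' \<or> b' \<le> a"
    proof (rule ccontr)
      assume "\<not> ?thesis"
      then have "max a a' < min b b'"
        using NI_nonempty[of "(a, b)"] NI_nonempty[of "(a', b')"] meet[OF ab] meet[OF ab'(1)] by auto
      then obtain y where "max a a' < y" "y < min b b'" using dense by blast
      then have "(a, b) = (a', b')"
        using meet[OF ab] meet[OF ab'(1)] by (intro NI_disjoint[of a b "n\<^sub>0 + j" a' b' y]) auto
      then show False using ab'(2) by blast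
    qed
  qed
  also have "((v + ?R) - (v - 2 * ?R)) / (l_min * ?R) = 3 / l_min"
    using R l_min(1) by (simp add: field_simps)
  finally show ?thesis .
qed

text \<open>The ancestor in generation \<open>j\<close> of a descendant meeting \<open>V\<close>
  meets \<open>V\<close> too. There are boundedly many such ancestors, and the weights below each of
  them add up to lam^(k - j) times its own.\<close>

lemma sum_meeting_le:
  assumes V: "\<And>x y. x \<in> V \<Longrightarrow> y \<in> V \<Longrightarrow> dist x y \<le> \<rho> ^ (n\<^sub>0 + j)" and "j \<le> k"
  shows "(\<Sum>\<Delta>\<in>meeting k V. f (red (n\<^sub>0 + k) \<Delta>)) \<le> lam ^ (k - j) * ((3 / l_min + 1) * f_max)"
proof -
  have k: "k = j + (k - j)" using \<open>j \<le> k\<close> by simp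
  have mD: "meeting j V \<subseteq> D j" by (auto simp: meeting_def)
  have D_eq: "D k = (\<Union>\<Delta>\<in>D j. desc (n\<^sub>0 + j) (k - j) \<Delta>)"
    using desc_add[OF base, of j "k - j"] k by simp
  have "meeting k V \<subseteq> (\<Union>\<Delta>\<in>meeting j V. desc (n\<^sub>0 + j) (k - j) \<Delta>)"
  proof
    fix \<Delta> assume "\<Delta> \<in> meeting k V"
    then have \<Delta>: "\<Delta> \<in> D k" "ivl_set \<Delta> \<inter> V \<noteq> {}" by (auto simp: meeting_def)
    then obtain \<Delta>' where *: "\<Delta>' \<in> D j" "\<Delta> \<in> desc (n\<^sub>0 + j) (k - j) \<Delta>'" unfolding D_eq by blast
    then have "ivl_set \<Delta> \<subseteq> ivl_set \<Delta>'" by (simp add: desc_def)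
    then have "\<Delta>' \<in> meeting j V" using *(1) \<Delta>(2) unfolding meeting_def by blast
    then show "\<Delta> \<in> (\<Union>\<Delta>\<in>meeting j V. desc (n\<^sub>0 + j) (k - j) \<Delta>)" using *(2) by blast
  qed
  moreover have "(\<Union>\<Delta>\<in>meeting j V. desc (n\<^sub>0 + j) (k - j) \<Delta>) \<subseteq> D k" unfolding D_eq using mD by blast
  moreover have "0 \<le> f (red (n\<^sub>0 + k) \<Delta>)" if "\<Delta> \<in> D k" for \<Delta>
    using f_pos[OF desc_G[OF base base_G that]] by simp
  ultimately have "(\<Sum>\<Delta>\<in>meeting k V. f (red (n\<^sub>0 + k) \<Delta>))
      \<le> (\<Sum>\<Delta>\<in>(\<Union>\<Delta>\<in>meeting j V. desc (n\<^sub>0 + j) (k - j) \<Delta>). f (red (n\<^sub>0 + k) \<Delta>))"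
    using finite_subset[OF _ finite_desc] by (intro sum_mono2) blast+
  also have "\<dots> = (\<Sum>\<Delta>\<in>meeting j V. \<Sum>\<Delta>'\<in>desc (n\<^sub>0 + j) (k - j) \<Delta>. f (red (n\<^sub>0 + k) \<Delta>'))"
    by (rule sum_desc_add[OF base mD])
  also have "\<dots> = (\<Sum>\<Delta>\<in>meeting j V. lam ^ (k - j) * f (red (n\<^sub>0 + j) \<Delta>))"
  proof (rule sum.cong[OF refl])
    fix \<Delta> assume "\<Delta> \<in> meeting j V"
    then have *: "\<Delta> \<in> D j" using mD by blast
    then have "\<Delta> \<in> NI (n\<^sub>0 + j)" by (simp add: desc_def)
    moreover have "n\<^sub>0 + k = n\<^sub>0 + j + (k - j)" using \<open>j \<le> k\<close> by simp
    ultimately show "(\<Sum>\<Delta>'\<in>desc (n\<^sub>0 + j) (k - j) \<Delta>. f (red (n\<^sub>0 + k) \<Delta>')) = lam ^ (k - j) * f (red (n\<^sub>0 + j) \<Delta>)"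
      using sum_desc[OF _ desc_G[OF base base_G *], of "k - j"] by simp
  qed
  also have "\<dots> \<le> (\<Sum>\<Delta>\<in>meeting j V. lam ^ (k - j) * f_max)"
    using lam_ge_1 f_max[OF desc_G[OF base base_G subsetD[OF mD]]] by (intro sum_mono mult_left_mono) auto
  also have "\<dots> = real (card (meeting j V)) * (lam ^ (k - j) * f_max)" by simp
  also have "\<dots> \<le> (3 / l_min + 1) * (lam ^ (k - j) * f_max)"
    using card_meeting_le[OF V] lam_ge_1 f_max_pos by (intro mult_right_mono) auto
  finally show ?thesis by (simp add: mult_ac)
qed

text \<open>Rounding \<open>r\<close> up to a power of \<rho> costs less than a factor 1 / \<rho>.
  The least index with a power below \<open>r\<close> is positive by the upper bound on
  \<open>r\<close>, so it has a predecessor.\<close>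

lemma exists_scale:
  assumes "0 < r" "r \<le> \<rho> ^ n\<^sub>0"
  shows "\<exists>j. r \<le> \<rho> ^ (n\<^sub>0 + j) \<and> \<rho> ^ (n\<^sub>0 + j + 1) < r"
proof -
  obtain i where "\<rho> ^ i < r" using real_arch_pow_inv[OF assms(1)] rho by blast
  moreover have "\<rho> ^ (n\<^sub>0 + i) \<le> \<rho> ^ i" using rho by (intro power_decreasing) auto
  ultimately have ex: "\<exists>i. \<rho> ^ (n\<^sub>0 + i) < r" by (intro exI[of _ i]) linarith
  define l where "l = (LEAST i. \<rho> ^ (n\<^sub>0 + i) < r)"
  have l: "\<rho> ^ (n\<^sub>0 + l) < r" unfolding l_def by (rule LeastI_ex[OF ex])
  with assms(2) have "l \<noteq> 0" by (metis add_0_right not_less)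
  then obtain j where j: "l = Suc j" by (cases l) auto
  have "\<not> \<rho> ^ (n\<^sub>0 + j) < r" using not_less_Least[of j "\<lambda>i. \<rho> ^ (n\<^sub>0 + i) < r"] j by (simp add: l_def)
  then show ?thesis using l j by (intro exI[of _ j]) auto
qed

lemma hausdorff_measure_K_nonzero:
  assumes t: "0 \<le> t" "t < ln lam / \<bar>ln \<rho>\<bar>"
  shows "hausdorff_measure t K \<noteq> 0"
proof -
  define s where "s = ln lam / \<bar>ln \<rho>\<bar>"
  have s: "0 < s" "t \<le> s" using t by (auto simp: s_def)
  let ?c\<^sub>0 = "f (red n\<^sub>0 (a\<^sub>0, b\<^sub>0))"
  define M where "M = (3 / l_min + 1) * f_max"
  have "0 < 3 / l_min" using l_min(1) by simp
  then have M: "0 < M" unfolding M_def using f_max_pos by (intro mult_pos_pos) linarith+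
  \<comment> \<open>\<open>H\<close> pays for starting at level \<open>n\<^sub>0\<close> and for
    rounding each radius to a power of \<rho>.\<close>
  define H where "H = (\<rho> ^ (n\<^sub>0 + 1)) powr s"
  have H: "0 < H" using rho by (simp add: H_def)
  have lam: "0 < lam" using lam_ge_1 by simp
  show ?thesis
  proof (rule hausdorff_measure_nonzeroI[OF compact_K _ _ t(1) s(2,1)])
    show "0 < ?c\<^sub>0 / M * H" using f_pos[OF base_G] M H by simp
    show "0 < \<rho> ^ n\<^sub>0" using rho by simp
    fix I and V :: "nat \<Rightarrow> real set" and r
    assume I: "finite I" "K \<subseteq> (\<Union>i\<in>I. V i)" and r: "\<And>i. i \<in> I \<Longrightarrow> 0 < r i \<and> r i \<le> \<rho> ^ n\<^sub>0"
      and V: "\<And>i x y. i \<in> I \<Longrightarrow> x \<in> V i \<Longrightarrow> y \<in> V i \<Longrightarrow> dist x y \<le> r i"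
    have "\<forall>i\<in>I. \<exists>j. r i \<le> \<rho> ^ (n\<^sub>0 + j) \<and> \<rho> ^ (n\<^sub>0 + j + 1) < r i" using r exists_scale by blast
    from bchoice[OF this] obtain J where J:
      "\<And>i. i \<in> I \<Longrightarrow> r i \<le> \<rho> ^ (n\<^sub>0 + J i)" "\<And>i. i \<in> I \<Longrightarrow> \<rho> ^ (n\<^sub>0 + J i + 1) < r i" by blast
    \<comment> \<open>The sum merely serves as an upper bound for all \<open>J i\<close>: cover sets
      of different sizes are compared in one generation that is late enough for each.\<close>
    define k where "k = (\<Sum>i\<in>I. J i)"
    have Jk: "J i \<le> k" if "i \<in> I" for i unfolding k_def using that I(1) by (intro member_le_sum) auto
    let ?w = "\<lambda>\<Delta>. f (red (n\<^sub>0 + k) \<Delta>)"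
    have w0: "0 \<le> ?w \<Delta>" if "\<Delta> \<in> D k" for \<Delta> using f_pos[OF desc_G[OF base base_G that]] by simp
    have "lam ^ k * ?c\<^sub>0 = (\<Sum>\<Delta>\<in>D k. ?w \<Delta>)" using sum_desc[OF base base_G] by simp
    also have "\<dots> \<le> (\<Sum>\<Delta>\<in>D k. \<Sum>i\<in>I. if ivl_set \<Delta> \<inter> V i \<noteq> {} then ?w \<Delta> else 0)"
    proof (rule sum_mono)
      fix \<Delta> assume \<Delta>: "\<Delta> \<in> D k"
      then have "\<Delta> \<in> NI (n\<^sub>0 + k)" by (simp add: desc_def)
      \<comment> \<open>Every net interval contains a point of \<open>K\<close>, so the cover
        reaches each descendant and its weight is counted at least once.\<close>
      then obtain y where "y \<in> K" "y \<in> ivl_set \<Delta>" by (cases \<Delta>) (force simp: mem_NI_iff)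
      then obtain i where i: "i \<in> I" "ivl_set \<Delta> \<inter> V i \<noteq> {}" using I(2) by blast
      then have "?w \<Delta> = (if ivl_set \<Delta> \<inter> V i \<noteq> {} then ?w \<Delta> else 0)" by simp
      also have "\<dots> \<le> (\<Sum>i\<in>I. if ivl_set \<Delta> \<inter> V i \<noteq> {} then ?w \<Delta> else 0)"
        using w0[OF \<Delta>] i(1) I(1)
        by (intro member_le_sum[where f = "\<lambda>i. if ivl_set \<Delta> \<inter> V i \<noteq> {} then ?w \<Delta> else 0"]) auto
      finally show "?w \<Delta> \<le> (\<Sum>i\<in>I. if ivl_set \<Delta> \<inter> V i \<noteq> {} then ?w \<Delta> else 0)" .
    qed
    also have "\<dots> = (\<Sum>i\<in>I. \<Sum>\<Delta>\<in>meeting k (V i). ?w \<Delta>)"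
      by (subst sum.swap) (simp add: meeting_def sum.inter_filter[OF finite_desc])
    also have "\<dots> \<le> (\<Sum>i\<in>I. lam ^ (k - J i) * M)"
    proof (rule sum_mono)
      fix i assume i: "i \<in> I"
      have "dist x y \<le> \<rho> ^ (n\<^sub>0 + J i)" if "x \<in> V i" "y \<in> V i" for x y
        using V[OF i that] J(1)[OF i] by linarith
      then show "(\<Sum>\<Delta>\<in>meeting k (V i). ?w \<Delta>) \<le> lam ^ (k - J i) * M"
        unfolding M_def using Jk[OF i] by (intro sum_meeting_le) auto
    qed
    also have "\<dots> \<le> (\<Sum>i\<in>I. lam ^ k * (M / H) * r i powr s)"
    proof (rule sum_mono)
      fix i assume i: "i \<in> I"
      have "(1 / lam) ^ J i * H = (\<rho> ^ (n\<^sub>0 + J i + 1)) powr s"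
        unfolding H_def rho_powr_power using rho_powr_dim by (simp add: s_def power_add)
      also have "\<dots> \<le> r i powr s" using J(2)[OF i] s(1) rho by (intro powr_mono2) auto
      finally have "(1 / lam) ^ J i \<le> r i powr s / H" using H by (simp add: pos_le_divide_eq)
      then have "lam ^ k * M * (1 / lam) ^ J i \<le> lam ^ k * M * (r i powr s / H)"
        using lam M by (intro mult_left_mono) auto
      moreover have "lam ^ (k - J i) = lam ^ k * (1 / lam) ^ J i"
        using power_diff[of lam "J i" k] Jk[OF i] lam by (simp add: power_one_over divide_inverse power_inverse)
      ultimately show "lam ^ (k - J i) * M \<le> lam ^ k * (M / H) * r i powr s" by (simp add: mult_ac)
    qed
    also have "\<dots> = lam ^ k * ((M / H) * (\<Sum>i\<in>I. r i powr s))" by (simp add: sum_distrib_left mult_ac)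
    finally have "?c\<^sub>0 \<le> (M / H) * (\<Sum>i\<in>I. r i powr s)"
      by (simp only: mult_le_cancel_left_pos[OF zero_less_power[OF lam]])
    then show "?c\<^sub>0 / M * H \<le> (\<Sum>i\<in>I. r i powr s)" using M H by (simp add: field_simps)
  qed
qed

theorem hausdorff_dim_K: "hausdorff_dim K = ereal (ln lam / \<bar>ln \<rho>\<bar>)"
  using lam_ge_1 by (intro hausdorff_dim_eqI hausdorff_measure_K_eq_0 hausdorff_measure_K_nonzero) auto

end

section \<open>The essential class\<close>

context unit_ifs begin

abbreviation "cv \<equiv> char_vector m \<rho> d K"

lemma reduced_part_char_vector: "reduced_part (cv n \<Delta>) = red n \<Delta>"
  by (simp add: reduced_part_def char_vector_def red_vector_def)

lemma child_count_pos_iff: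
  assumes "\<Delta> \<in> NI n"
  shows "0 < child_count m \<rho> d K (red n \<Delta>) \<gamma> \<longleftrightarrow> (\<exists>\<Delta>'\<in>CH n \<Delta>. red (Suc n) \<Delta>' = \<gamma>)"
  using finite_CH by (auto simp: child_count_eq[OF assms] card_gt_0_iff)

lemma parent_vec_child_count_pos:
  assumes "parent_vec m \<rho> d K \<alpha> \<beta>"
  shows "0 < child_count m \<rho> d K (reduced_part \<alpha>) (reduced_part \<beta>)"
  using assms by (auto simp: parent_vec_def reduced_part_char_vector child_count_pos_iff)

text \<open>Grouping the children by type produces a row of the incidence matrix; this links the
  eigenvector equation to the weights on net intervals.\<close>

lemma sum_CH_eq_mat_apply:
  assumes \<Delta>: "\<Delta> \<in> NI n" and i: "i < length \<gamma>s" "red n \<Delta> = \<gamma>s ! i" and "distinct \<gamma>s"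
    and closed: "\<And>\<Delta>'. \<Delta>' \<in> CH n \<Delta> \<Longrightarrow> red (Suc n) \<Delta>' \<in> set \<gamma>s"
    and f: "\<And>j. j < length \<gamma>s \<Longrightarrow> f (\<gamma>s ! j) = x j"
  shows "(\<Sum>\<Delta>'\<in>CH n \<Delta>. f (red (Suc n) \<Delta>')) =
    mat_apply (length \<gamma>s) (\<lambda>i j. real (child_count m \<rho> d K (\<gamma>s ! i) (\<gamma>s ! j))) x i"
proof -
  have "(\<Sum>\<Delta>'\<in>CH n \<Delta>. f (red (Suc n) \<Delta>'))
      = (\<Sum>\<gamma>\<in>set \<gamma>s. \<Sum>\<Delta>' | \<Delta>' \<in> CH n \<Delta> \<and> red (Suc n) \<Delta>' = \<gamma>. f (red (Suc n) \<Delta>'))"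
    using closed by (intro sum.group[symmetric] finite_CH) auto
  also have "\<dots> = (\<Sum>\<gamma>\<in>set \<gamma>s. real (child_count m \<rho> d K (\<gamma>s ! i) \<gamma>) * f \<gamma>)"
    by (intro sum.cong refl) (simp add: child_count_eq[OF \<Delta>] flip: i(2))
  also have "\<dots> = (\<Sum>j<length \<gamma>s. real (child_count m \<rho> d K (\<gamma>s ! i) (\<gamma>s ! j)) * f (\<gamma>s ! j))"
    using bij_betw_nth[OF \<open>distinct \<gamma>s\<close> refl refl]
    by (rule sum.reindex_bij_betw[symmetric, where g = "\<lambda>\<gamma>. real (child_count m \<rho> d K (\<gamma>s ! i) \<gamma>) * f \<gamma>"])
  finally show ?thesis using f by (simp add: mat_apply_def)
qed

text \<open>\<Delta> shares only its type with an element of \<Omega>. That element is realised by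
  some \<Gamma>, and equal child counts give \<Gamma> a child of the same type as \<Delta>'; closure
  of \<Omega> applies to this child.\<close>

lemma essential_class_closed:
  assumes ess: "essential_class m \<rho> d K \<Omega>" and \<Delta>: "\<Delta> \<in> NI n" "red n \<Delta> \<in> reduced_part ` \<Omega>"
    and "\<Delta>' \<in> CH n \<Delta>"
  shows "red (Suc n) \<Delta>' \<in> reduced_part ` \<Omega>"
proof -
  obtain \<alpha> where \<alpha>: "\<alpha> \<in> \<Omega>" "red n \<Delta> = reduced_part \<alpha>" using \<Delta>(2) by blast
  have "\<alpha> \<in> char_vectors m \<rho> d K"
    using ess \<alpha>(1) unfolding essential_class_def loop_class_def by blast
  then obtain i \<Gamma> where \<Gamma>: "\<Gamma> \<in> NI i" "cv i \<Gamma> = \<alpha>" by (auto simp: char_vectors_def)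
  have eq: "red i \<Gamma> = red n \<Delta>" using \<alpha>(2) \<Gamma>(2) reduced_part_char_vector by metis
  have "0 < child_count m \<rho> d K (red n \<Delta>) (red (Suc n) \<Delta>')"
    using child_count_pos_iff[OF \<Delta>(1)] assms(4) by blast
  then obtain \<Gamma>' where \<Gamma>': "\<Gamma>' \<in> CH i \<Gamma>" "red (Suc i) \<Gamma>' = red (Suc n) \<Delta>'"
    using child_count_pos_iff[OF \<Gamma>(1)] unfolding eq by blast
  have "parent_vec m \<rho> d K \<alpha> (cv (Suc i) \<Gamma>')" unfolding parent_vec_def using \<Gamma> \<Gamma>'(1) by blast
  then have "cv (Suc i) \<Gamma>' \<in> \<Omega>" using ess \<alpha>(1) unfolding essential_class_def by blast
  then show ?thesis using \<Gamma>'(2) reduced_part_char_vector by (metis image_eqI)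
qed

text \<open>Forgetting positions sends each parent step to a positive matrix entry, so connectivity
  of the loop class becomes irreducibility. Distinctness is what identifies the two indices for a
  path with a single vertex.\<close>

lemma path_rtrancl:
  assumes "p \<noteq> []" "successively (parent_vec m \<rho> d K) p" "reduced_part ` set p \<subseteq> set \<gamma>s" "distinct \<gamma>s"
    and "i < length \<gamma>s" "\<gamma>s ! i = reduced_part (hd p)" "j < length \<gamma>s" "\<gamma>s ! j = reduced_part (last p)"
  shows "(i, j) \<in> {(i, j). i < length \<gamma>s \<and> j < length \<gamma>s \<and>
            0 < real (child_count m \<rho> d K (\<gamma>s ! i) (\<gamma>s ! j))}\<^sup>*"
  using assms
proof (induction p arbitrary: i)
  case (Cons \<alpha> p)
  show ?case
  proof (cases "p = []")
    case True
    then have "\<gamma>s ! i = \<gamma>s ! j" using Cons.prems(6,8) by simp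
    then have "i = j" using Cons.prems(4,5,7) by (simp add: nth_eq_iff_index_eq)
    then show ?thesis by simp
  next
    case False
    then have "reduced_part (hd p) \<in> set \<gamma>s" using Cons.prems(3) by auto
    then obtain l where l: "l < length \<gamma>s" "\<gamma>s ! l = reduced_part (hd p)" by (auto simp: in_set_conv_nth)
    have "parent_vec m \<rho> d K \<alpha> (hd p)" "successively (parent_vec m \<rho> d K) p"
      using Cons.prems(2) False by (auto simp: successively_Cons)
    then have "0 < child_count m \<rho> d K (\<gamma>s ! i) (\<gamma>s ! l)"
      using parent_vec_child_count_pos Cons.prems(6) l(2) by simp
    moreover have "(l, j) \<in> {(i, j). i < length \<gamma>s \<and> j < length \<gamma>s \<and>
            0 < real (child_count m \<rho> d K (\<gamma>s ! i) (\<gamma>s ! j))}\<^sup>*"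
      using Cons.prems False l \<open>successively (parent_vec m \<rho> d K) p\<close> by (intro Cons.IH) auto
    ultimately show ?thesis using Cons.prems(5) l(1) by (intro converse_rtrancl_into_rtrancl[of i l]) auto
  qed
qed simp

lemma hausdorff_dim_eq_spectral_radius:
  assumes ess: "essential_class m \<rho> d K \<Omega>" and dist: "distinct \<gamma>s" and \<gamma>s: "set \<gamma>s = reduced_part ` \<Omega>"
  shows "hausdorff_dim K = ereal (ln (spectral_radius (incidence_matrix m \<rho> d K \<gamma>s)) / \<bar>ln \<rho>\<bar>)"
proof -
  let ?n = "length \<gamma>s"
  define a where "a = (\<lambda>i j. real (child_count m \<rho> d K (\<gamma>s ! i) (\<gamma>s ! j)))"
  have \<Omega>: "\<Omega> \<noteq> {}" "\<Omega> \<subseteq> char_vectors m \<rho> d K"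
    "\<And>\<alpha> \<beta>. \<alpha> \<in> \<Omega> \<Longrightarrow> \<beta> \<in> \<Omega> \<Longrightarrow>
       \<exists>p. admissible_path m \<rho> d K p \<and> set p \<subseteq> \<Omega> \<and> hd p = \<alpha> \<and> last p = \<beta>"
    using ess unfolding essential_class_def loop_class_def by blast+
  have I: "incidence_matrix m \<rho> d K \<gamma>s = real_mat ?n a"
    by (auto simp: incidence_matrix_def real_mat_def a_def)
  have n: "0 < ?n" using \<Omega>(1) \<gamma>s by (cases \<gamma>s) auto
  have irred: "(i, j) \<in> {(i, j). i < ?n \<and> j < ?n \<and> 0 < a i j}\<^sup>*" if ij: "i < ?n" "j < ?n" for i j
  proof -
    have "\<gamma>s ! i \<in> reduced_part ` \<Omega>" "\<gamma>s ! j \<in> reduced_part ` \<Omega>" using nth_mem[OF ij(1)] nth_mem[OF ij(2)] unfolding \<gamma>s .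
    then obtain \<alpha> \<beta> where \<alpha>: "\<alpha> \<in> \<Omega>" "\<gamma>s ! i = reduced_part \<alpha>" and \<beta>: "\<beta> \<in> \<Omega>" "\<gamma>s ! j = reduced_part \<beta>" by blast
    obtain p where p: "admissible_path m \<rho> d K p" "set p \<subseteq> \<Omega>" "hd p = \<alpha>" "last p = \<beta>" using \<Omega>(3) \<alpha>(1) \<beta>(1) by blast
    have sub: "reduced_part ` set p \<subseteq> set \<gamma>s" unfolding \<gamma>s using p(2) by (rule image_mono)
    have ap: "p \<noteq> []" "successively (parent_vec m \<rho> d K) p" using p(1) by (simp_all add: admissible_path_def)
    show ?thesis unfolding a_def
      by (rule path_rtrancl[OF ap sub dist ij(1) _ ij(2)]) (simp_all only: p(3,4) \<alpha>(2) \<beta>(2))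
  qed
  have nonneg: "0 \<le> a i j" for i j by (simp add: a_def)
  obtain x where x: "\<And>i. i < ?n \<Longrightarrow> 0 < x i"
      "\<And>i. i < ?n \<Longrightarrow> mat_apply ?n a x i = spectral_radius (real_mat ?n a) * x i"
    using perron_frobenius_vector[OF n nonneg irred] by blast
  \<comment> \<open>The list has distinct entries, so the chosen index is unique and
    \<open>f\<close> carries the vector \<open>x\<close> from list positions over to types.\<close>
  define f where "f = (\<lambda>\<gamma>. x (SOME i. i < ?n \<and> \<gamma>s ! i = \<gamma>))"
  have f: "f (\<gamma>s ! j) = x j" if "j < ?n" for j
  proof -
    have "(SOME i. i < ?n \<and> \<gamma>s ! i = \<gamma>s ! j) = j"
      using that dist by (intro some_equality) (auto simp: nth_eq_iff_index_eq)
    then show ?thesis by (simp add: f_def)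
  qed
  obtain \<alpha> where \<alpha>: "\<alpha> \<in> \<Omega>" using \<Omega>(1) by blast
  then have "\<alpha> \<in> char_vectors m \<rho> d K" using \<Omega>(2) by blast
  then obtain n\<^sub>0 a\<^sub>0 b\<^sub>0 where base: "(a\<^sub>0, b\<^sub>0) \<in> NI n\<^sub>0" "cv n\<^sub>0 (a\<^sub>0, b\<^sub>0) = \<alpha>"
    by (auto simp: char_vectors_def)
  have closed: "red (Suc n) \<Delta>' \<in> set \<gamma>s" if "\<Delta> \<in> NI n" "red n \<Delta> \<in> set \<gamma>s" "\<Delta>' \<in> CH n \<Delta>" for n \<Delta> \<Delta>'
    using that unfolding \<gamma>s by (rule essential_class_closed[OF ess])
  interpret weighted_net m \<rho> d K "set \<gamma>s" f "spectral_radius (real_mat ?n a)" n\<^sub>0 a\<^sub>0 b\<^sub>0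
  proof
    show "0 < fst \<gamma>" if mem: "\<gamma> \<in> set \<gamma>s" for \<gamma>
    proof -
      obtain \<beta> where \<beta>: "\<beta> \<in> \<Omega>" "\<gamma> = reduced_part \<beta>" using mem unfolding \<gamma>s by blast
      have "\<beta> \<in> char_vectors m \<rho> d K" using \<Omega>(2) \<beta>(1) by (rule subsetD)
      then obtain n \<Delta> where "\<Delta> \<in> NI n" "\<beta> = cv n \<Delta>" by (auto simp: char_vectors_def)
      then have "\<Delta> \<in> NI n" "\<gamma> = red n \<Delta>" using \<beta>(2) by (simp_all add: reduced_part_char_vector)
      then show ?thesis using NI_nonempty[of \<Delta> n] rho by (simp add: red_vector_def norm_length_def)
    qed
    show "0 < f \<gamma>" if "\<gamma> \<in> set \<gamma>s" for \<gamma> using that f x(1) by (auto simp: in_set_conv_nth)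
    show "(\<Sum>\<Delta>'\<in>CH n \<Delta>. f (red (Suc n) \<Delta>')) = spectral_radius (real_mat ?n a) * f (red n \<Delta>)"
      if \<Delta>: "\<Delta> \<in> NI n" "red n \<Delta> \<in> set \<gamma>s" for n \<Delta>
    proof -
      obtain i where i: "i < ?n" "red n \<Delta> = \<gamma>s ! i" using \<Delta>(2) by (auto simp: in_set_conv_nth)
      have "(\<Sum>\<Delta>'\<in>CH n \<Delta>. f (red (Suc n) \<Delta>')) = mat_apply ?n a x i"
        unfolding a_def using closed[OF \<Delta>] f by (intro sum_CH_eq_mat_apply[OF \<Delta>(1) i dist])
      then show ?thesis using x(2)[OF i(1)] f[OF i(1)] i(2) by simp
    qed
    show "red n\<^sub>0 (a\<^sub>0, b\<^sub>0) \<in> set \<gamma>s"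
      unfolding \<gamma>s using \<alpha> base(2) reduced_part_char_vector by (metis image_eqI)
    show "red (Suc n) \<Delta>' \<in> set \<gamma>s" if "\<Delta> \<in> NI n" "red n \<Delta> \<in> set \<gamma>s" "\<Delta>' \<in> CH n \<Delta>" for n \<Delta> \<Delta>'
      by (rule closed[OF that])
  qed (simp, rule base(1))
  show ?thesis unfolding I by (rule hausdorff_dim_K)
qed

end

theorem proposition3p8:
  fixes m :: nat and \<rho> :: real and d :: "nat \<Rightarrow> real" and K :: "real set"
    and \<Omega>\<^sub>0 :: "char_vec set" and \<gamma>s :: "red_vec list"
  assumes "m \<ge> 1" and "0 < \<rho>" and "\<rho> < 1"
    and "d 0 = 0" and "strict_mono_on {0..m} d"
    and "compact K" and "K \<noteq> {}" and "K = (\<Union>j\<in>{0..m}. ifs_map \<rho> d j ` K)"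
    and "convex hull K = {0..1}"
    and "finite_type m \<rho> d"
    and "essential_class m \<rho> d K \<Omega>\<^sub>0"
    and "distinct \<gamma>s" and "set \<gamma>s = reduced_part ` \<Omega>\<^sub>0"
  shows "hausdorff_dim K =
           ereal (ln (spectral_radius (incidence_matrix m \<rho> d K \<gamma>s)) / \<bar>ln \<rho>\<bar>)"
proof -
  interpret unit_ifs m \<rho> d K by (rule unit_ifs.intro[OF assms(2-4,6-9)])
  show ?thesis by (rule hausdorff_dim_eq_spectral_radius[OF assms(11-13)])
qed

end
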